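(* Consider the eigenvalue problem $$i\frac{dy}{dx}=\lambda y,\quad x\in\mathbb{R},$$ for the operator $M=i\frac{d}{dx}$ in $L^2(\mathbb{R})$. It has a continuous spectrum given by $\mathbb{R}$. Corresponding to the continuum eigenvalue $\lambda\in\mathbb{R}$ there is the continuum eigenfunction $y_\lambda(x)=\exp(-i\lambda x)$. The continuum eigenfunctions are orthogonal (in the generalized sense) with respect to the inner product $\langle f,g\rangle=\int_{-\infty}^{\infty}f(x)\overline{g(x)}\,dx$. The set of continuum eigenfunctions is complete, and any function $f$ satisfying $\int_{-\infty}^{\infty}|f(x)|^2dx<\infty$ has the representation $$f(x)\sim\int_{\mathbb{R}}F(\lambda)\exp(-i\lambda x)\,d\lambda,\qquad\text{where}\quad F(\lambda)\sim\frac{1}{2\pi}\int_{-\infty}^{\infty}f(x)\exp(i\lambda x)\,dx.$$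
   Context: A number $\lambda\in\mathbb{C}$ is a continuum eigenvalue of an operator $M$ if there is a sequence of (non-zero) functions $y_n$ in the domain of $M$ such that $\frac{\|(M-\lambda)y_n\|}{\|y_n\|}\to 0$ as $n\to\infty$. If the functions $y_n$ converge pointwise to a function $y$, then $y$ is called a continuum eigenfunction of $M$ corresponding to $\lambda$, and $\lambda$ is said to belong to the continuous spectrum of $M$. (If $y_n$ converges to $y$ in the sense of the space, $\lambda$ is an eigenvalue with eigenfunction $y$ and is said to belong to the discrete spectrum.) Here the space is $L^2(\mathbb{R})$ with the inner product above, and $M=i\,d/dx$ has its natural domain: the locally absolutely continuous $y\in L^2(\mathbb{R})$ with $y'\in L^2(\mathbb{R})$. Orthogonality of the continuum eigenfunctions (which are not in $L^2(\mathbb{R})$) is understood in the sense of generalized functions: $\int_{\mathbb{R}}y_\lambda(x)\overline{y_\mu(x)}\,dx$ is a constant multiple of the Dirac delta $\delta(\lambda-\mu)$. Completeness means that an $f\in L^2(\mathbb{R})$ whose generalized coefficients $\int_{\mathbb{R}}f(x)\overline{y_\lambda(x)}\,dx$ vanish for almost every $\lambda\in\mathbb{R}$ is zero almost everywhere. The symbol $\sim$ indicates that the integrals are understood in the $L^2$ sense, i.e. as limits in $L^2(\mathbb{R})$ of the integrals over $[-R,R]$ as $R\to\infty$. $F$ is called the Fourier transform of $f$, and $f$ the inverse Fourier transform of $F$. *)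

theory Defs
  imports "HOL-Analysis.Analysis"
begin

definition L2 :: "(real \<Rightarrow> complex) set" where
  "L2 = {f. f \<in> borel_measurable lebesgue \<and> integrable lebesgue (\<lambda>x. (cmod (f x))\<^sup>2)}"

text \<open>Elements of \<open>L2\<close> are functions, not classes; \<open>L2_norm\<close> is meaningful only on \<open>L2\<close>
  (the Bochner integral of a non-integrable function is 0).\<close>

definition L2_norm :: "(real \<Rightarrow> complex) \<Rightarrow> real" where
  "L2_norm f = sqrt (LINT x|lebesgue. (cmod (f x))\<^sup>2)"

definition L2_tendsto :: "('i \<Rightarrow> real \<Rightarrow> complex) \<Rightarrow> (real \<Rightarrow> complex) \<Rightarrow> 'i filter \<Rightarrow> bool" where
  "L2_tendsto G f A \<longleftrightarrow>
     f \<in> L2 \<and> (\<forall>\<^sub>F r in A. G r \<in> L2) \<and>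
     ((\<lambda>r. L2_norm (\<lambda>x. G r x - f x)) \<longlongrightarrow> 0) A"

text \<open>The inner product over the symmetric interval from \<open>-R\<close> to \<open>R\<close>. Inner products over the
  whole line that need not converge absolutely are limits of it as \<open>R\<close> tends to infinity.\<close>

definition trunc_inner :: "real \<Rightarrow> (real \<Rightarrow> complex) \<Rightarrow> (real \<Rightarrow> complex) \<Rightarrow> complex" where
  "trunc_inner R f g = (LINT x:{-R..R}|lebesgue. f x * cnj (g x))"

text \<open>The epsilon-delta definition; a set \<open>d\<close> with \<open>d division_of \<Union>d\<close> is a finite family of
  non-overlapping compact intervals.\<close>

definition absolutely_continuous_on :: "real set \<Rightarrow> (real \<Rightarrow> complex) \<Rightarrow> bool" where
  "absolutely_continuous_on S f \<longleftrightarrow>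
     (\<forall>\<epsilon>>0. \<exists>\<delta>>0. \<forall>d. d division_of \<Union>d \<and> \<Union>d \<subseteq> S \<and> (\<Sum>K\<in>d. Sup K - Inf K) < \<delta> \<longrightarrow>
        (\<Sum>K\<in>d. cmod (f (Sup K) - f (Inf K))) < \<epsilon>)"

definition locally_absolutely_continuous :: "(real \<Rightarrow> complex) \<Rightarrow> bool" where
  "locally_absolutely_continuous f \<longleftrightarrow> (\<forall>a b. absolutely_continuous_on {a..b} f)"

text \<open>The operator \<open>i d/dx\<close>. The derivative of a locally absolutely continuous function exists
  almost everywhere; \<open>z\<close> is any representative of it. On the exceptional null set
  \<open>vector_derivative\<close> takes an arbitrary fixed value.\<close>

definition dom_M :: "(real \<Rightarrow> complex) set" where
  "dom_M = {y \<in> L2. locally_absolutely_continuous y \<and>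
     (\<exists>z\<in>L2. AE x in lebesgue. (y has_vector_derivative z x) (at x))}"

definition op_M :: "(real \<Rightarrow> complex) \<Rightarrow> real \<Rightarrow> complex" where
  "op_M y x = \<i> * vector_derivative y (at x)"

text \<open>In the following definitions an operator is given by its domain \<open>D\<close> and its action \<open>T\<close>.\<close>

definition approx_eigenseq ::
  "(real \<Rightarrow> complex) set \<Rightarrow> ((real \<Rightarrow> complex) \<Rightarrow> real \<Rightarrow> complex) \<Rightarrow> complex \<Rightarrow>
   (nat \<Rightarrow> real \<Rightarrow> complex) \<Rightarrow> bool" where
  "approx_eigenseq D T \<mu> Y \<longleftrightarrow>
     (\<forall>n. Y n \<in> D \<and> L2_norm (Y n) \<noteq> 0) \<and>
     (\<lambda>n. L2_norm (\<lambda>x. T (Y n) x - \<mu> * Y n x) / L2_norm (Y n)) \<longlonglongrightarrow> 0"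

definition continuum_eigenfunction ::
  "(real \<Rightarrow> complex) set \<Rightarrow> ((real \<Rightarrow> complex) \<Rightarrow> real \<Rightarrow> complex) \<Rightarrow> complex \<Rightarrow>
   (real \<Rightarrow> complex) \<Rightarrow> bool" where
  "continuum_eigenfunction D T \<mu> y \<longleftrightarrow>
     \<not> (AE x in lebesgue. y x = 0) \<and>
     (\<exists>Y. approx_eigenseq D T \<mu> Y \<and> (\<forall>x. (\<lambda>n. Y n x) \<longlonglongrightarrow> y x))"

definition continuous_spectrum ::
  "(real \<Rightarrow> complex) set \<Rightarrow> ((real \<Rightarrow> complex) \<Rightarrow> real \<Rightarrow> complex) \<Rightarrow> complex set" where
  "continuous_spectrum D T = {\<mu>. \<exists>y. continuum_eigenfunction D T \<mu> y}"

definition eigfun :: "real \<Rightarrow> real \<Rightarrow> complex" where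
  "eigfun l x = exp (- \<i> * of_real l * of_real x)"

text \<open>Boundedness of the set where \<open>\<phi>\<close> is non-zero means that the support is compact.\<close>

definition test_function :: "(real \<Rightarrow> complex) \<Rightarrow> bool" where
  "test_function \<phi> \<longleftrightarrow>
     (\<forall>n. ((\<lambda>g x. vector_derivative g (at x)) ^^ n) \<phi> differentiable_on UNIV) \<and>
     bounded {x. \<phi> x \<noteq> 0}"

text \<open>For every \<open>m\<close>, the inner product of \<open>y l\<close> and \<open>y m\<close>, as a generalized function
  of \<open>l\<close>, is a constant multiple (independent of \<open>m\<close>) of the Dirac delta at \<open>m\<close>.\<close>

definition delta_orthogonal :: "(real \<Rightarrow> real \<Rightarrow> complex) \<Rightarrow> bool" where
  "delta_orthogonal y \<longleftrightarrow>
     (\<exists>c. c \<noteq> 0 \<and> (\<forall>m \<phi>. test_function \<phi> \<longrightarrow>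
        ((\<lambda>R. LINT l|lebesgue. \<phi> l * trunc_inner R (y l) (y m)) \<longlongrightarrow> c * \<phi> m) at_top))"

definition generalized_coeffs ::
  "(real \<Rightarrow> real \<Rightarrow> complex) \<Rightarrow> (real \<Rightarrow> complex) \<Rightarrow> (real \<Rightarrow> complex) \<Rightarrow> bool" where
  "generalized_coeffs y f c \<longleftrightarrow> L2_tendsto (\<lambda>R l. trunc_inner R f (y l)) c at_top"

definition complete_family :: "(real \<Rightarrow> real \<Rightarrow> complex) \<Rightarrow> bool" where
  "complete_family y \<longleftrightarrow>
     (\<forall>f\<in>L2. \<forall>c. generalized_coeffs y f c \<and> (AE l in lebesgue. c l = 0) \<longrightarrow>
        (AE x in lebesgue. f x = 0))"

end

theory Submission
  imports Defs "HOL-Probability.Sinc_Integral" "HOL-Probability.Characteristic_Functions"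
begin

text \<open>The theorem combines two independent arguments.

The spectrum. The operator \<open>i d/dx\<close> is symmetric on its domain: for \<open>y\<close> in the domain the function \<open>\<bar>y\<bar>\<^sup>2\<close> is locally
absolutely continuous and integrable, and so is its derivative \<open>2 Re (y' cnj y)\<close>, so the integral of the derivative
over \<open>[-R, R]\<close> is a difference of boundary values which can only tend to zero. Hence \<open>Re \<langle>y', y\<rangle> = 0\<close>
(\<open>Re_derivative_inner_zero\<close>), and the Cauchy-Schwarz inequality gives
\<open>\<bar>Im \<mu>\<bar> \<parallel>y\<parallel> \<le> \<parallel>(M - \<mu>) y\<parallel>\<close> (\<open>Im_bound_dom_M\<close>). A number with approximate eigenfunctions is therefore real.
Conversely the waves \<open>exp (- i l x)\<close> become approximate eigenfunctions after multiplication by the slowly varying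
factor \<open>1 / (1 + (x / n)\<^sup>2)\<close>, whose logarithmic derivative is at most \<open>1 / n\<close>
(\<open>eigfun_continuum_eigenfunction\<close>).

Fourier inversion. Everything rests on the inequality \<open>\<parallel>FT f\<parallel>\<^sup>2 \<le> 2 \<pi> \<parallel>f\<parallel>\<^sup>2\<close> (\<open>FT_L2\<close>) for the Fourier integral of an
integrable \<open>f\<close> in \<open>L2\<close>. It is obtained by averaging \<open>\<bar>FT f\<bar>\<^sup>2\<close> against a wide Gaussian: by duality the average equals
a double integral of \<open>f x cnj (f y)\<close> against a narrow Gaussian in \<open>x - y\<close> of known mass, which is bounded by
\<open>\<parallel>f\<parallel>\<^sup>2\<close> times that mass. Since \<open>L2\<close> is complete (\<open>L2_complete\<close>), the inequality makes the truncated Fourier integrals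
converge, in both directions. The transform \<open>F\<close> of \<open>f\<close> and the inverse transform \<open>h\<close> of \<open>F\<close> thus exist, and it remains
to see that \<open>h = 2 \<pi> f\<close>. It suffices to compare integrals over intervals \<open>[a, b]\<close>. Moving both transforms onto
the indicator function of \<open>[a, b]\<close> by duality turns it into its Dirichlet integral, a difference of two values of
the sine integral \<open>Si\<close>, and this tends boundedly to \<open>2 \<pi>\<close> inside the interval and to \<open>0\<close> outside
(\<open>FT_clip_pairing\<close>, \<open>Fourier_inversion_intervals\<close>).

Completeness of the eigenfunctions follows since \<open>h\<close>, hence \<open>f\<close>, is controlled by \<open>F\<close>. Orthogonality uses the same
bounded convergence: integration by parts replaces the Dirichlet kernel by its primitive \<open>2 Si (R (l - m))\<close>, which
tends to \<open>\<pi> sgn (l - m)\<close>, and the derivative of the sign function is twice the Dirac delta.\<close>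

section \<open>The space of square-integrable functions\<close>

lemma L2_measurable [measurable_dest]: "f \<in> L2 \<Longrightarrow> f \<in> borel_measurable lebesgue"
  by (simp add: L2_def)

lemma L2_sq_integrable: "f \<in> L2 \<Longrightarrow> integrable lebesgue (\<lambda>x. (cmod (f x))\<^sup>2)"
  by (simp add: L2_def)

lemma L2_norm_nonneg [simp]: "0 \<le> L2_norm f"
  by (simp add: L2_norm_def)

lemma L2_norm_pos: "L2_norm f \<noteq> 0 \<Longrightarrow> 0 < L2_norm f"
  by (simp add: less_le)

lemma L2_norm_sq: "(L2_norm f)\<^sup>2 = (LINT x|lebesgue. (cmod (f x))\<^sup>2)"
  by (simp add: L2_norm_def)

lemma L2_norm_cong_AE:
  assumes "f \<in> borel_measurable lebesgue" "g \<in> borel_measurable lebesgue"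
    and "AE x in lebesgue. f x = g x"
  shows "L2_norm f = L2_norm g"
  unfolding L2_norm_def using assms by (intro arg_cong[where f=sqrt] integral_cong_AE) auto

lemma L2_dominated:
  assumes "g \<in> L2" "f \<in> borel_measurable lebesgue" "\<And>x. cmod (f x) \<le> c * cmod (g x)"
  shows "f \<in> L2"
proof -
  have "integrable lebesgue (\<lambda>x. (cmod (f x))\<^sup>2)"
  proof (rule Bochner_Integration.integrable_bound)
    show "integrable lebesgue (\<lambda>x. c\<^sup>2 * (cmod (g x))\<^sup>2)"
      using L2_sq_integrable[OF assms(1)] by simp
    show "(\<lambda>x. (cmod (f x))\<^sup>2) \<in> borel_measurable lebesgue" using assms(2) by measurable
    have "(cmod (f x))\<^sup>2 \<le> c\<^sup>2 * (cmod (g x))\<^sup>2" for x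
      using power_mono[OF assms(3)[of x], of 2] by (simp add: power_mult_distrib)
    then show "AE x in lebesgue. norm ((cmod (f x))\<^sup>2) \<le> norm (c\<^sup>2 * (cmod (g x))\<^sup>2)"
      by (simp add: abs_mult)
  qed
  then show ?thesis using assms(2) by (simp add: L2_def)
qed

lemma L2_norm_mono:
  assumes "g \<in> L2" "f \<in> borel_measurable lebesgue" "0 \<le> c" "AE x in lebesgue. cmod (f x) \<le> c * cmod (g x)"
  shows "L2_norm f \<le> c * L2_norm g"
proof -
  have "(LINT x|lebesgue. (cmod (f x))\<^sup>2) \<le> (LINT x|lebesgue. c\<^sup>2 * (cmod (g x))\<^sup>2)"
  proof (rule integral_mono_AE')
    show "integrable lebesgue (\<lambda>x. c\<^sup>2 * (cmod (g x))\<^sup>2)"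
      using L2_sq_integrable[OF assms(1)] by simp
    show "AE x in lebesgue. (cmod (f x))\<^sup>2 \<le> c\<^sup>2 * (cmod (g x))\<^sup>2"
      using assms(4)
      by eventually_elim (metis norm_ge_zero power_mono power_mult_distrib)
  qed auto
  then have "(L2_norm f)\<^sup>2 \<le> (c * L2_norm g)\<^sup>2"
    by (simp add: L2_norm_sq power_mult_distrib)
  then show ?thesis using assms(3) by (simp add: power2_le_iff_abs_le)
qed

lemma cmod_add_sq_le: "(cmod (a + b))\<^sup>2 \<le> 2 * (cmod a)\<^sup>2 + 2 * (cmod b)\<^sup>2"
proof -
  have "(cmod (a + b))\<^sup>2 \<le> (cmod a + cmod b)\<^sup>2"
    by (simp add: norm_triangle_ineq power_mono)
  also have "\<dots> \<le> 2 * (cmod a)\<^sup>2 + 2 * (cmod b)\<^sup>2"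
    using sum_squares_bound[of "cmod a" "cmod b"] by (simp add: power2_sum)
  finally show ?thesis .
qed

lemma L2_add:
  assumes "f \<in> L2" "g \<in> L2" shows "(\<lambda>x. f x + g x) \<in> L2"
proof -
  note [measurable] = L2_measurable[OF assms(1)] L2_measurable[OF assms(2)]
  have "integrable lebesgue (\<lambda>x. (cmod (f x + g x))\<^sup>2)"
  proof (rule Bochner_Integration.integrable_bound)
    show "integrable lebesgue (\<lambda>x. 2 * (cmod (f x))\<^sup>2 + 2 * (cmod (g x))\<^sup>2)"
      using L2_sq_integrable[OF assms(1)] L2_sq_integrable[OF assms(2)] by simp
    show "AE x in lebesgue. norm ((cmod (f x + g x))\<^sup>2) \<le> norm (2 * (cmod (f x))\<^sup>2 + 2 * (cmod (g x))\<^sup>2)"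
      using cmod_add_sq_le by simp
  qed measurable
  then show ?thesis by (simp add: L2_def)
qed

lemma L2_scale: "f \<in> L2 \<Longrightarrow> (\<lambda>x. c * f x) \<in> L2"
  by (rule L2_dominated[of f _ "cmod c"]) (auto simp: norm_mult L2_measurable)

lemma L2_diff: "f \<in> L2 \<Longrightarrow> g \<in> L2 \<Longrightarrow> (\<lambda>x. f x - g x) \<in> L2"
  using L2_add[of f "\<lambda>x. (-1) * g x"] L2_scale[of g "-1"] by simp

lemma cnj_borel_measurable [measurable]: "cnj \<in> borel_measurable borel"
  by (intro borel_measurable_continuous_onI continuous_intros)

lemma L2_cnj:
  assumes "f \<in> L2" shows "(\<lambda>x. cnj (f x)) \<in> L2"
proof -
  note [measurable] = L2_measurable[OF assms]
  show ?thesis by (rule L2_dominated[OF assms, of _ 1]) auto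
qed

lemma L2_restrict:
  assumes "f \<in> L2" "A \<in> sets lebesgue" shows "(\<lambda>x. indicator A x *\<^sub>R f x) \<in> L2"
proof -
  note [measurable] = L2_measurable[OF assms(1)] assms(2)
  show ?thesis by (rule L2_dominated[OF assms(1), of _ 1]) (auto simp: indicator_def)
qed

lemma L2_norm_scale: "L2_norm (\<lambda>x. c * f x) = cmod c * L2_norm f"
  by (simp add: L2_norm_def norm_mult power_mult_distrib real_sqrt_mult)

lemma L2_norm_minus_commute: "L2_norm (\<lambda>x. f x - g x) = L2_norm (\<lambda>x. g x - f x)"
  by (simp add: L2_norm_def norm_minus_commute)

lemma L2_mult_integrable:
  assumes "f \<in> L2" "g \<in> L2" shows "integrable lebesgue (\<lambda>x. f x * g x)"
proof (rule Bochner_Integration.integrable_bound)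
  note [measurable] = L2_measurable[OF assms(1)] L2_measurable[OF assms(2)]
  show "integrable lebesgue (\<lambda>x. (cmod (f x))\<^sup>2 + (cmod (g x))\<^sup>2)"
    using L2_sq_integrable[OF assms(1)] L2_sq_integrable[OF assms(2)] by simp
  show "(\<lambda>x. f x * g x) \<in> borel_measurable lebesgue" by measurable
  have "cmod (f x) * cmod (g x) \<le> (cmod (f x))\<^sup>2 + (cmod (g x))\<^sup>2" for x
    using sum_squares_bound[of "cmod (f x)" "cmod (g x)"]
      mult_nonneg_nonneg[OF norm_ge_zero[of "f x"] norm_ge_zero[of "g x"]] by linarith
  then show "AE x in lebesgue. norm (f x * g x) \<le> norm ((cmod (f x))\<^sup>2 + (cmod (g x))\<^sup>2)"
    by (simp add: norm_mult)
qed

lemma L2_Cauchy_Schwarz: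
  assumes "f \<in> L2" "g \<in> L2"
  shows "cmod (LINT x|lebesgue. f x * g x) \<le> L2_norm f * L2_norm g"
proof -
  note [measurable] = L2_measurable[OF assms(1)] L2_measurable[OF assms(2)]
  let ?I = "LINT x|lebesgue. cmod (f x * g x)"
  have I: "integrable lebesgue (\<lambda>x. cmod (f x * g x))"
    using L2_mult_integrable[OF assms] by simp
  have "(\<integral>\<^sup>+x. ennreal (cmod (f x)) * ennreal (cmod (g x)) \<partial>lebesgue)\<^sup>2
     \<le> (\<integral>\<^sup>+x. (ennreal (cmod (f x)))\<^sup>2 \<partial>lebesgue) * (\<integral>\<^sup>+x. (ennreal (cmod (g x)))\<^sup>2 \<partial>lebesgue)"
    by (rule Cauchy_Schwarz_nn_integral) measurable
  also have "(\<integral>\<^sup>+x. (ennreal (cmod (f x)))\<^sup>2 \<partial>lebesgue) = ennreal ((L2_norm f)\<^sup>2)"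
    unfolding L2_norm_sq using L2_sq_integrable[OF assms(1)]
    by (subst nn_integral_eq_integral[symmetric]) (auto simp: ennreal_power)
  also have "(\<integral>\<^sup>+x. (ennreal (cmod (g x)))\<^sup>2 \<partial>lebesgue) = ennreal ((L2_norm g)\<^sup>2)"
    unfolding L2_norm_sq using L2_sq_integrable[OF assms(2)]
    by (subst nn_integral_eq_integral[symmetric]) (auto simp: ennreal_power)
  also have "(\<integral>\<^sup>+x. ennreal (cmod (f x)) * ennreal (cmod (g x)) \<partial>lebesgue) = ennreal ?I"
    using I by (subst nn_integral_eq_integral[symmetric]) (auto simp: ennreal_mult norm_mult)
  finally have "?I\<^sup>2 \<le> (L2_norm f * L2_norm g)\<^sup>2"
    by (simp add: ennreal_power ennreal_mult[symmetric] power_mult_distrib)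
  then have "?I \<le> L2_norm f * L2_norm g"
    by (rule power2_le_imp_le) simp
  then show ?thesis
    using integral_norm_bound[of lebesgue "\<lambda>x. f x * g x"] by linarith
qed

lemma L2_norm_triangle:
  assumes "f \<in> L2" "g \<in> L2"
  shows "L2_norm (\<lambda>x. f x + g x) \<le> L2_norm f + L2_norm g"
proof -
  have *: "complex_of_real ((L2_norm h)\<^sup>2) = (LINT x|lebesgue. h x * cnj (h x))" for h
    unfolding L2_norm_sq integral_complex_of_real[symmetric]
    by (intro Bochner_Integration.integral_cong) (simp_all only: complex_norm_square)
  let ?h = "\<lambda>x. f x + g x"
  have h: "?h \<in> L2" and hc: "(\<lambda>x. cnj (?h x)) \<in> L2"
    using L2_cnj[OF L2_add[OF assms]] L2_add[OF assms] by auto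
  have "complex_of_real ((L2_norm ?h)\<^sup>2)
     = (LINT x|lebesgue. f x * cnj (?h x)) + (LINT x|lebesgue. g x * cnj (?h x))"
    unfolding * distrib_right
    by (rule Bochner_Integration.integral_add) (use assms hc in \<open>auto intro!: L2_mult_integrable\<close>)
  then have "cmod (complex_of_real ((L2_norm ?h)\<^sup>2))
     \<le> cmod (LINT x|lebesgue. f x * cnj (?h x)) + cmod (LINT x|lebesgue. g x * cnj (?h x))"
    by (simp add: norm_triangle_ineq)
  also have "\<dots> \<le> L2_norm f * L2_norm (\<lambda>x. cnj (?h x)) + L2_norm g * L2_norm (\<lambda>x. cnj (?h x))"
    by (intro add_mono L2_Cauchy_Schwarz assms hc)
  also have "L2_norm (\<lambda>x. cnj (?h x)) = L2_norm ?h"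
    by (simp add: L2_norm_def del: complex_cnj_add)
  finally have "L2_norm ?h * L2_norm ?h \<le> (L2_norm f + L2_norm g) * L2_norm ?h"
    by (simp add: power2_eq_square distrib_right del: of_real_mult of_real_power)
  then show ?thesis
    by (metis L2_norm_nonneg add_nonneg_nonneg less_eq_real_def mult_right_le_imp_le)
qed

lemma L2_norm_triangle_diff:
  assumes "f \<in> L2" "g \<in> L2" "h \<in> L2"
  shows "L2_norm (\<lambda>x. f x - h x) \<le> L2_norm (\<lambda>x. f x - g x) + L2_norm (\<lambda>x. g x - h x)"
  using L2_norm_triangle[OF L2_diff[OF assms(1,2)] L2_diff[OF assms(2,3)]] by simp

lemma L2_norm_eq_0_iff:
  assumes "f \<in> L2" shows "L2_norm f = 0 \<longleftrightarrow> (AE x in lebesgue. f x = 0)"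
  using integral_nonneg_eq_0_iff_AE[OF L2_sq_integrable[OF assms]]
  by (simp add: L2_norm_def)

text \<open>Nonnegative integrals need no integrability assumption, so that membership in \<open>L2\<close> and a bound on the norm can be
obtained together, in particular from Fatou's lemma.\<close>

lemma L2_norm_le_iff_nn_integral:
  assumes "f \<in> borel_measurable lebesgue" "0 \<le> c"
  shows "f \<in> L2 \<and> L2_norm f \<le> c \<longleftrightarrow> (\<integral>\<^sup>+x. ennreal ((cmod (f x))\<^sup>2) \<partial>lebesgue) \<le> ennreal (c\<^sup>2)"
proof -
  note [measurable] = assms(1)
  have 1: "(\<integral>\<^sup>+x. ennreal ((cmod (f x))\<^sup>2) \<partial>lebesgue) \<le> ennreal (c\<^sup>2)" if f: "f \<in> L2" "L2_norm f \<le> c"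
  proof -
    have "(\<integral>\<^sup>+x. ennreal ((cmod (f x))\<^sup>2) \<partial>lebesgue) = ennreal ((L2_norm f)\<^sup>2)"
      unfolding L2_norm_sq by (rule nn_integral_eq_integral[OF L2_sq_integrable[OF f(1)]]) auto
    also have "\<dots> \<le> ennreal (c\<^sup>2)" using f(2) by (intro ennreal_leI power_mono) auto
    finally show ?thesis .
  qed
  have 2: "f \<in> L2 \<and> L2_norm f \<le> c" if le: "(\<integral>\<^sup>+x. ennreal ((cmod (f x))\<^sup>2) \<partial>lebesgue) \<le> ennreal (c\<^sup>2)"
  proof -
    have I: "integrable lebesgue (\<lambda>x. (cmod (f x))\<^sup>2)"
      by (rule integrableI_nonneg) (use le in \<open>auto simp: le_less_trans[OF _ ennreal_less_top]\<close>)
    then have "ennreal ((L2_norm f)\<^sup>2) \<le> ennreal (c\<^sup>2)"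
      using le unfolding L2_norm_sq by (subst (asm) nn_integral_eq_integral) auto
    then have "(L2_norm f)\<^sup>2 \<le> c\<^sup>2" by simp
    then have "L2_norm f \<le> c" using assms(2) by (rule power2_le_imp_le)
    with I show ?thesis by (simp add: L2_def assms(1))
  qed
  show ?thesis using 1 2 by blast
qed


text \<open>The Riesz-Fischer argument. Along a sequence \<open>r k\<close> whose consecutive differences \<open>D k\<close> have norm at most \<open>2\<close> to the power
\<open>-k\<close>, the weighted sum of all \<open>2^k \<bar>D k\<bar>\<^sup>2\<close> still has finite integral, so it is finite almost everywhere. As
\<open>\<bar>t\<bar> \<le> 2^k t\<^sup>2 + 2^(-k)\<close>, the differences are then absolutely summable almost everywhere, and the sequence has a
pointwise limit. Fatou's lemma turns the Cauchy condition into convergence in norm to this limit.\<close>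

lemma L2_complete:
  fixes G :: "real \<Rightarrow> real \<Rightarrow> complex"
  assumes G: "\<And>r. G r \<in> L2"
    and Cauchy: "\<And>e. e > 0 \<Longrightarrow> \<exists>N. \<forall>r\<ge>N. \<forall>q\<ge>N. L2_norm (\<lambda>x. G r x - G q x) \<le> e"
  shows "\<exists>F. L2_tendsto G F at_top"
proof -
  note [measurable] = L2_measurable[OF G]
  have "\<exists>N. \<forall>k. \<forall>r\<ge>N k. \<forall>q\<ge>N k. L2_norm (\<lambda>x. G r x - G q x) \<le> (1/2) ^ k"
    by (intro choice allI Cauchy) simp
  then obtain N :: "nat \<Rightarrow> real"
    where N: "\<And>k r q. r \<ge> N k \<Longrightarrow> q \<ge> N k \<Longrightarrow> L2_norm (\<lambda>x. G r x - G q x) \<le> (1/2) ^ k"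
    by blast
  \<comment> \<open>The summand \<open>real k\<close> makes the sequence unbounded, the other one puts \<open>r k\<close> beyond \<open>N j\<close> for all \<open>j\<close> up to \<open>k\<close>.\<close>
  define r where "r k = real k + (\<Sum>j\<le>k. \<bar>N j\<bar>)" for k
  have r_ge: "r k \<ge> N j" if "j \<le> k" for j k
  proof -
    have "\<bar>N j\<bar> \<le> (\<Sum>j\<le>k. \<bar>N j\<bar>)" using that by (intro member_le_sum) auto
    then show ?thesis unfolding r_def by linarith
  qed
  have r_top: "filterlim r at_top sequentially"
  proof (rule filterlim_at_top_mono[OF filterlim_real_sequentially])
    show "\<forall>\<^sub>F k in sequentially. real k \<le> r k" by (simp add: r_def sum_nonneg)
  qed
  define D where "D k x = G (r (Suc k)) x - G (r k) x" for k x
  have [measurable]: "D k \<in> borel_measurable lebesgue" for k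
    unfolding D_def[abs_def] by measurable
  have D: "(\<integral>\<^sup>+x. ennreal ((cmod (D k x))\<^sup>2) \<partial>lebesgue) \<le> ennreal (((1/2)^k)\<^sup>2)" for k
  proof -
    have "L2_norm (D k) \<le> (1/2)^k" unfolding D_def[abs_def] by (intro N r_ge) auto
    moreover have "D k \<in> L2" unfolding D_def[abs_def] by (intro L2_diff G)
    ultimately show ?thesis using L2_norm_le_iff_nn_integral[of "D k" "(1/2)^k"] by auto
  qed
  have "(\<integral>\<^sup>+x. (\<Sum>k. ennreal (2^k * (cmod (D k x))\<^sup>2)) \<partial>lebesgue)
      = (\<Sum>k. \<integral>\<^sup>+x. ennreal (2^k * (cmod (D k x))\<^sup>2) \<partial>lebesgue)"
    by (rule nn_integral_suminf) measurable
  also have "\<dots> \<le> (\<Sum>k. ennreal ((1/2)^k))"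
  proof (intro suminf_le summableI)
    fix k
    have "(\<integral>\<^sup>+x. ennreal (2^k * (cmod (D k x))\<^sup>2) \<partial>lebesgue)
        = ennreal (2^k) * (\<integral>\<^sup>+x. ennreal ((cmod (D k x))\<^sup>2) \<partial>lebesgue)"
      by (subst nn_integral_cmult[symmetric]) (auto simp: ennreal_mult)
    also have "\<dots> \<le> ennreal (2^k) * ennreal (((1/2)^k)\<^sup>2)"
      by (intro mult_left_mono D) auto
    also have "\<dots> = ennreal ((1/2)^k)"
      by (simp add: ennreal_mult[symmetric] power2_eq_square power_one_over)
    finally show "(\<integral>\<^sup>+x. ennreal (2^k * (cmod (D k x))\<^sup>2) \<partial>lebesgue) \<le> ennreal ((1/2)^k)" .
  qed
  also have "(\<Sum>k. ennreal ((1/2)^k)) = ennreal (\<Sum>k. (1/2)^k)"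
    by (intro suminf_ennreal2 summable_geometric) auto
  also have "\<dots> < \<infinity>" by simp
  finally have "AE x in lebesgue. (\<Sum>k. ennreal (2^k * (cmod (D k x))\<^sup>2)) \<noteq> \<infinity>"
    by (intro nn_integral_noteq_infinite) auto
  then have conv: "AE x in lebesgue. convergent (\<lambda>k. G (r k) x)"
  proof eventually_elim
    case (elim x)
    then have "summable (\<lambda>k. 2^k * (cmod (D k x))\<^sup>2)"
      by (intro summable_suminf_not_top) auto
    then have "summable (\<lambda>k. 2^k * (cmod (D k x))\<^sup>2 + (1/2)^k)"
      by (intro summable_add summable_geometric) auto
    moreover have "norm (D k x) \<le> 2^k * (cmod (D k x))\<^sup>2 + (1/2)^k" for k
    proof -
      have "0 \<le> (2^k * cmod (D k x) - 1)\<^sup>2" by simp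
      then have "2 * 2^k * cmod (D k x) \<le> 2^k * (2^k * (cmod (D k x))\<^sup>2) + 1"
        by (simp add: power2_eq_square algebra_simps)
      then have "(2 * 2^k * cmod (D k x)) / 2^k \<le> (2^k * (2^k * (cmod (D k x))\<^sup>2) + 1) / 2^k"
        by (intro divide_right_mono) auto
      then have "2 * cmod (D k x) \<le> 2^k * (cmod (D k x))\<^sup>2 + (1/2)^k"
        by (simp add: add_divide_distrib power_one_over)
      then show ?thesis using norm_ge_zero[of "D k x"] by linarith
    qed
    ultimately have "summable (\<lambda>k. D k x)"
      by (rule summable_comparison_test'[where N = 0])
    then have "convergent (\<lambda>n. (\<Sum>k<n. D k x) + G (r 0) x)"
      by (intro convergent_add convergent_const) (simp add: summable_iff_convergent)
    moreover have "(\<Sum>k<n. D k x) + G (r 0) x = G (r n) x" for n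
      unfolding D_def by (simp add: sum_lessThan_telescope[of "\<lambda>k. G (r k) x"])
    ultimately show ?case by simp
  qed
  define F where "F x = lim (\<lambda>k. G (r k) x)" for x
  have [measurable]: "F \<in> borel_measurable lebesgue"
    unfolding F_def[abs_def] by (intro borel_measurable_lim_metric) measurable
  have close: "(\<lambda>x. G q x - F x) \<in> L2 \<and> L2_norm (\<lambda>x. G q x - F x) \<le> e"
    if e: "e > 0" and M: "\<forall>q\<ge>M. \<forall>q'\<ge>M. L2_norm (\<lambda>x. G q x - G q' x) \<le> e" and q: "q \<ge> M" for e M q
  proof -
    have "(\<integral>\<^sup>+x. ennreal ((cmod (G q x - F x))\<^sup>2) \<partial>lebesgue)
        \<le> (\<integral>\<^sup>+x. liminf (\<lambda>k. ennreal ((cmod (G q x - G (r k) x))\<^sup>2)) \<partial>lebesgue)"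
    proof (rule nn_integral_mono_AE)
      show "AE x in lebesgue. ennreal ((cmod (G q x - F x))\<^sup>2)
          \<le> liminf (\<lambda>k. ennreal ((cmod (G q x - G (r k) x))\<^sup>2))"
        using conv
      proof eventually_elim
        case (elim x)
        then have "(\<lambda>k. G (r k) x) \<longlonglongrightarrow> F x"
          unfolding F_def by (simp add: convergent_LIMSEQ_iff)
        then have "(\<lambda>k. ennreal ((cmod (G q x - G (r k) x))\<^sup>2)) \<longlonglongrightarrow> ennreal ((cmod (G q x - F x))\<^sup>2)"
          by (intro tendsto_intros)
        then show ?case by (simp only: lim_imp_Liminf[OF trivial_limit_sequentially] order_refl)
      qed
    qed
    also have "\<dots> \<le> liminf (\<lambda>k. \<integral>\<^sup>+x. ennreal ((cmod (G q x - G (r k) x))\<^sup>2) \<partial>lebesgue)"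
      by (rule nn_integral_liminf) measurable
    also have "\<dots> \<le> ennreal (e\<^sup>2)"
    proof (rule Liminf_le)
      have "\<forall>\<^sub>F k in sequentially. r k \<ge> M" using r_top by (simp add: filterlim_at_top)
      then show "\<forall>\<^sub>F k in sequentially. (\<integral>\<^sup>+x. ennreal ((cmod (G q x - G (r k) x))\<^sup>2) \<partial>lebesgue) \<le> ennreal (e\<^sup>2)"
      proof eventually_elim
        case (elim k)
        then show ?case
          using L2_norm_le_iff_nn_integral[of "\<lambda>x. G q x - G (r k) x" e] M q e L2_diff[OF G G] by auto
      qed
    qed simp
    finally show ?thesis
      using e by (subst L2_norm_le_iff_nn_integral) auto
  qed
  have F: "F \<in> L2"
  proof -
    obtain M where M: "\<forall>q\<ge>M. \<forall>q'\<ge>M. L2_norm (\<lambda>x. G q x - G q' x) \<le> 1" using Cauchy[of 1] by auto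
    have "(\<lambda>x. G M x - F x) \<in> L2" using close[OF _ M, of M] by simp
    from L2_diff[OF G[of M] this] show ?thesis by simp
  qed
  have "((\<lambda>q. L2_norm (\<lambda>x. G q x - F x)) \<longlongrightarrow> 0) at_top"
  proof (rule tendstoI)
    fix e :: real assume e: "e > 0"
    then obtain M where M: "\<forall>q\<ge>M. \<forall>q'\<ge>M. L2_norm (\<lambda>x. G q x - G q' x) \<le> e/2"
      using Cauchy[of "e/2"] by auto
    have "L2_norm (\<lambda>x. G q x - F x) \<le> e/2" if "q \<ge> M" for q
      using close[OF _ M that] e by simp
    then show "\<forall>\<^sub>F q in at_top. dist (L2_norm (\<lambda>x. G q x - F x)) 0 < e"
      unfolding eventually_at_top_linorder using e by (intro exI[of _ M] allI impI) (simp add: le_less_trans[of _ "e/2"])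
  qed
  then show ?thesis using F G by (auto simp: L2_tendsto_def)
qed

lemma L2_tendsto_norm:
  assumes "L2_tendsto G F A"
  shows "((\<lambda>r. L2_norm (G r)) \<longlongrightarrow> L2_norm F) A"
proof -
  have F: "F \<in> L2" and G: "\<forall>\<^sub>F r in A. G r \<in> L2" and l: "((\<lambda>r. L2_norm (\<lambda>x. G r x - F x)) \<longlongrightarrow> 0) A"
    using assms by (auto simp: L2_tendsto_def)
  have "\<forall>\<^sub>F r in A. norm (L2_norm (G r) - L2_norm F) \<le> L2_norm (\<lambda>x. G r x - F x)"
    using G
  proof eventually_elim
    case (elim r)
    have "L2_norm (G r) \<le> L2_norm (\<lambda>x. G r x - F x) + L2_norm F"
      using L2_norm_triangle[OF L2_diff[OF elim F] F] by simp
    moreover have "L2_norm F \<le> L2_norm (\<lambda>x. F x - G r x) + L2_norm (G r)"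
      using L2_norm_triangle[OF L2_diff[OF F elim] elim] by simp
    ultimately show ?case using L2_norm_minus_commute[of F "G r"] by simp
  qed
  then have "((\<lambda>r. L2_norm (G r) - L2_norm F) \<longlongrightarrow> 0) A"
    using l by (rule Lim_null_comparison)
  then show ?thesis by (simp add: LIM_zero_iff)
qed

text \<open>Convergence in norm implies weak convergence. The pairing is bilinear, without conjugation, because this is the form
in which the Fourier integral is its own transpose.\<close>

lemma L2_tendsto_pairing:
  assumes "L2_tendsto G F A" and k: "k \<in> L2"
  shows "((\<lambda>r. LINT x|lebesgue. G r x * k x) \<longlongrightarrow> (LINT x|lebesgue. F x * k x)) A"
proof -
  have F: "F \<in> L2" and G: "\<forall>\<^sub>F r in A. G r \<in> L2" and l: "((\<lambda>r. L2_norm (\<lambda>x. G r x - F x)) \<longlongrightarrow> 0) A"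
    using assms by (auto simp: L2_tendsto_def)
  have "\<forall>\<^sub>F r in A. norm ((LINT x|lebesgue. G r x * k x) - (LINT x|lebesgue. F x * k x))
      \<le> L2_norm (\<lambda>x. G r x - F x) * L2_norm k"
    using G
  proof eventually_elim
    case (elim r)
    have "(LINT x|lebesgue. G r x * k x) - (LINT x|lebesgue. F x * k x)
       = (LINT x|lebesgue. (G r x - F x) * k x)"
      using L2_mult_integrable[OF elim k] L2_mult_integrable[OF F k]
      by (simp add: left_diff_distrib)
    then show ?case using L2_Cauchy_Schwarz[OF L2_diff[OF elim F] k] by simp
  qed
  moreover have "((\<lambda>r. L2_norm (\<lambda>x. G r x - F x) * L2_norm k) \<longlongrightarrow> 0) A"
    using tendsto_mult_right[OF l, of "L2_norm k"] by simp
  ultimately have "((\<lambda>r. (LINT x|lebesgue. G r x * k x) - (LINT x|lebesgue. F x * k x)) \<longlongrightarrow> 0) A"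
    by (rule Lim_null_comparison)
  then show ?thesis by (simp add: LIM_zero_iff)
qed

lemma L2_tendsto_cong_AE:
  assumes "L2_tendsto G F A" "H \<in> borel_measurable lebesgue" "AE x in lebesgue. F x = H x"
  shows "L2_tendsto G H A"
proof -
  have F: "F \<in> L2" and G: "\<forall>\<^sub>F r in A. G r \<in> L2" and l: "((\<lambda>r. L2_norm (\<lambda>x. G r x - F x)) \<longlongrightarrow> 0) A"
    using assms by (auto simp: L2_tendsto_def)
  note [measurable] = assms(2) L2_measurable[OF F]
  have "integrable lebesgue (\<lambda>x. (cmod (H x))\<^sup>2)"
    using assms(3) by (intro integrable_cong_AE_imp[OF L2_sq_integrable[OF F]]) auto
  then have H: "H \<in> L2" by (simp add: L2_def)
  have "\<forall>\<^sub>F r in A. L2_norm (\<lambda>x. G r x - F x) = L2_norm (\<lambda>x. G r x - H x)"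
    using G
  proof eventually_elim
    case (elim r)
    note [measurable] = L2_measurable[OF elim]
    show ?case using assms(3) by (intro L2_norm_cong_AE) auto
  qed
  with l have "((\<lambda>r. L2_norm (\<lambda>x. G r x - H x)) \<longlongrightarrow> 0) A"
    by (rule Lim_transform_eventually)
  with H G show ?thesis by (simp add: L2_tendsto_def)
qed

lemma L2_tendsto_scale:
  assumes "L2_tendsto G F A"
  shows "L2_tendsto (\<lambda>r x. c * G r x) (\<lambda>x. c * F x) A"
proof -
  have F: "F \<in> L2" and G: "\<forall>\<^sub>F r in A. G r \<in> L2" and l: "((\<lambda>r. L2_norm (\<lambda>x. G r x - F x)) \<longlongrightarrow> 0) A"
    using assms by (auto simp: L2_tendsto_def)
  have "((\<lambda>r. L2_norm (\<lambda>x. c * G r x - c * F x)) \<longlongrightarrow> 0) A"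
    using tendsto_mult_left[OF l, of "cmod c"]
    by (simp add: right_diff_distrib[symmetric] L2_norm_scale)
  with F G show ?thesis by (auto simp: L2_tendsto_def L2_scale elim: eventually_mono)
qed

lemma L2_tendsto_cnj:
  assumes "L2_tendsto G F A"
  shows "L2_tendsto (\<lambda>r x. cnj (G r x)) (\<lambda>x. cnj (F x)) A"
proof -
  have "L2_norm (\<lambda>x. cnj (G r x) - cnj (F x)) = L2_norm (\<lambda>x. G r x - F x)" for r
    unfolding L2_norm_def complex_cnj_diff[symmetric] complex_mod_cnj ..
  with assms show ?thesis by (auto simp: L2_tendsto_def L2_cnj elim: eventually_mono)
qed

text \<open>The truncation of \<open>f\<close> to \<open>[-R, R]\<close>. A square-integrable function becomes integrable when it is truncated, so that its
Fourier integral exists as a Lebesgue integral.\<close>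

definition clip :: "real \<Rightarrow> (real \<Rightarrow> complex) \<Rightarrow> real \<Rightarrow> complex" where
  "clip R f x = indicator {-R..R} x *\<^sub>R f x"

lemma indicator_Icc_integrable: "integrable lebesgue (indicat_real {a..b::real})"
  by (rule integrable_real_indicator) (simp, cases "a \<le> b", auto)

lemma clip_L2: "f \<in> L2 \<Longrightarrow> clip R f \<in> L2"
  unfolding clip_def[abs_def] by (rule L2_restrict) auto

lemma clip_integrable:
  assumes "f \<in> L2" shows "integrable lebesgue (clip R f)"
proof -
  have "(\<lambda>x. complex_of_real (indicator {-R..R} x)) \<in> L2"
  proof -
    have "(cmod (complex_of_real (indicator {-R..R} x)))\<^sup>2 = indicat_real {-R..R} x" for x
      by (simp add: indicator_def)
    then show ?thesis
      using indicator_Icc_integrable[of "-R" R] by (simp add: L2_def measurable_completion)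
  qed
  from L2_mult_integrable[OF this assms] show ?thesis
    by (simp add: clip_def[abs_def] scaleR_conv_of_real)
qed

lemma L2_norm_clip_le: "f \<in> L2 \<Longrightarrow> L2_norm (clip R f) \<le> L2_norm f"
  using L2_norm_mono[of f "clip R f" 1] L2_measurable[OF clip_L2]
  by (auto simp: clip_def indicator_def)

lemma clip_cnj: "clip R (\<lambda>x. cnj (f x)) = (\<lambda>x. cnj (clip R f x))"
  by (simp add: clip_def fun_eq_iff)

lemma indicator_Icc_L2: "(indicator {a..b} :: real \<Rightarrow> complex) \<in> L2"
  and indicator_Icc_integrable_complex: "integrable lebesgue (indicator {a..b} :: real \<Rightarrow> complex)"
proof -
  have "(cmod (indicator {a..b} x))\<^sup>2 = indicat_real {a..b} x" for x by (simp add: indicator_def)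
  then show "(indicator {a..b} :: real \<Rightarrow> complex) \<in> L2"
    using indicator_Icc_integrable[of a b] by (simp add: L2_def measurable_completion)
  have "(\<lambda>x. complex_of_real (indicat_real {a..b} x)) = indicator {a..b}"
    by (auto simp: fun_eq_iff indicator_def)
  moreover have "integrable lebesgue (\<lambda>x. complex_of_real (indicat_real {a..b} x))"
    by (intro integrable_of_real indicator_Icc_integrable)
  ultimately show "integrable lebesgue (indicator {a..b} :: real \<Rightarrow> complex)" by simp
qed

lemma L2_norm_tail_tendsto_0:
  assumes "f \<in> L2"
  shows "((\<lambda>R. L2_norm (\<lambda>x. clip R f x - f x)) \<longlongrightarrow> 0) at_top"
proof -
  have [measurable]: "(\<lambda>x. indicator {-R..R} x *\<^sub>R f x) \<in> borel_measurable lebesgue" for R :: real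
    by (rule L2_measurable[OF L2_restrict[OF assms]]) simp
  note [measurable] = L2_measurable[OF assms]
  have "((\<lambda>R::real. LINT x|lebesgue. (cmod (indicator {-R..R} x *\<^sub>R f x - f x))\<^sup>2) \<longlongrightarrow> (LINT x::real|lebesgue. 0)) at_top"
  proof (rule integral_dominated_convergence_at_top)
    show "integrable lebesgue (\<lambda>x. (cmod (f x))\<^sup>2)" by (rule L2_sq_integrable[OF assms])
    show "AE x in lebesgue. ((\<lambda>R::real. (cmod (indicator {-R..R} x *\<^sub>R f x - f x))\<^sup>2) \<longlongrightarrow> 0) at_top"
    proof (rule AE_I2)
      fix x :: real
      have "\<forall>\<^sub>F R::real in at_top. (cmod (indicator {-R..R} x *\<^sub>R f x - f x))\<^sup>2 = 0"
        using eventually_ge_at_top[of "\<bar>x\<bar>"] by eventually_elim (auto simp: indicator_def)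
      then show "((\<lambda>R::real. (cmod (indicator {-R..R} x *\<^sub>R f x - f x))\<^sup>2) \<longlongrightarrow> 0) at_top"
        by (rule tendsto_eventually)
    qed
    show "\<forall>\<^sub>F R in at_top. AE x in lebesgue. norm ((cmod (indicator {-R..R} x *\<^sub>R f x - f x))\<^sup>2) \<le> (cmod (f x))\<^sup>2"
      by (auto simp: indicator_def)
  qed measurable
  from tendsto_real_sqrt[OF this] show ?thesis by (simp add: L2_norm_def clip_def)
qed

lemma clip_tendsto:
  assumes "f \<in> L2"
  shows "L2_tendsto (\<lambda>R. clip R f) f at_top"
  using assms L2_norm_tail_tendsto_0[OF assms] by (simp add: L2_tendsto_def clip_L2)

section \<open>The fundamental theorem of calculus for absolutely continuous functions\<close>

lemma division_member_real:
  fixes K :: "real set"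
  assumes "d division_of S" "K \<in> d"
  obtains "Inf K \<le> Sup K" "K = {Inf K..Sup K}" "Inf K \<in> S" "Sup K \<in> S" "measure lebesgue K = Sup K - Inf K"
proof -
  obtain u v where K: "K = cbox u v" using division_ofD(4)[OF assms] by blast
  moreover have "K \<noteq> {}" "K \<subseteq> S" using division_ofD(2,3)[OF assms] by auto
  moreover from calculation have "u \<le> v" "u \<in> S" "v \<in> S" by auto
  ultimately show ?thesis using that by simp
qed

text \<open>A gauge is chosen to be small in two senses. At points where the derivative exists it makes the increment of \<open>u\<close> close
to its linear approximation. At points of the exceptional null set it stays inside an open superset of small measure, and
there absolute continuity bounds the sum of all increments of \<open>u\<close>. The existence of the
gauge integral is obtained along with its value.\<close>

lemma absolutely_continuous_on_FTC:
  fixes u w :: "real \<Rightarrow> complex"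
  assumes ac: "absolutely_continuous_on {a..b} u" and ab: "a \<le> b" and N: "negligible N"
    and der: "\<And>x. x \<in> {a..b} - N \<Longrightarrow> (u has_vector_derivative w x) (at x)"
  shows "(w has_integral (u b - u a)) {a..b}"
proof (rule has_integral_spike[OF N])
  \<comment> \<open>With the value \<open>0\<close> on \<open>N\<close>, tags in \<open>N\<close> contribute only increments of \<open>u\<close> to the error.\<close>
  define v where "v x = (if x \<in> N then 0 else w x)" for x
  show "w x = v x" if "x \<in> {a..b} - N" for x using that by (simp add: v_def)
  show "(v has_integral (u b - u a)) {a..b}"
    unfolding has_integral_real
  proof (intro allI impI)
    fix e :: real assume e: "e > 0"
    obtain \<delta> where \<delta>: "\<delta> > 0"
      and ac': "\<And>d. d division_of \<Union>d \<Longrightarrow> \<Union>d \<subseteq> {a..b} \<Longrightarrow> (\<Sum>K\<in>d. Sup K - Inf K) < \<delta> \<Longrightarrow>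
        (\<Sum>K\<in>d. cmod (u (Sup K) - u (Inf K))) < e/2"
      using ac e unfolding absolutely_continuous_on_def by (meson half_gt_zero)
    have Nm: "N \<in> sets lebesgue" "emeasure lebesgue N = 0"
      using N by (auto simp: negligible_iff_null_sets)
    obtain U where U: "open U" "N \<subseteq> U" "U - N \<in> lmeasurable" "emeasure lebesgue (U - N) < ennreal \<delta>"
      using sets_lebesgue_outer_open[OF Nm(1) \<delta>] by metis
    have Um: "U \<in> sets lebesgue" using U(1) by auto
    have U\<delta>: "emeasure lebesgue U < ennreal \<delta>"
      using U(4) N Um by (simp add: emeasure_Diff_null_set negligible_iff_null_sets)
    define \<epsilon> where "\<epsilon> = e / (2 * (b - a + 1))"
    have \<epsilon>: "\<epsilon> > 0" using e ab by (simp add: \<epsilon>_def)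
    have "\<exists>r>0. \<forall>y. \<bar>y - x\<bar> < r \<longrightarrow> cmod (u y - u x - (y - x) *\<^sub>R w x) \<le> \<epsilon> * \<bar>y - x\<bar>"
      if "x \<in> {a..b} - N" for x
      using der[OF that] \<epsilon> unfolding has_vector_derivative_def has_derivative_at_alt
      by (metis real_norm_def)
    then obtain r where r: "\<And>x. x \<in> {a..b} - N \<Longrightarrow> r x > 0"
      "\<And>x y. x \<in> {a..b} - N \<Longrightarrow> \<bar>y - x\<bar> < r x \<Longrightarrow> cmod (u y - u x - (y - x) *\<^sub>R w x) \<le> \<epsilon> * \<bar>y - x\<bar>"
      by metis
    define \<gamma> where "\<gamma> x = (if x \<in> N then U else if x \<in> {a..b} then ball x (r x) else UNIV)" for x
    have gauge: "gauge \<gamma>" using U r by (auto simp: gauge_def \<gamma>_def)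
    have close: "cmod ((\<Sum>(x,K)\<in>p. measure lborel K *\<^sub>R v x) - (u b - u a)) < e"
      if p: "p tagged_division_of {a..b}" and fine: "\<gamma> fine p" for p
    proof -
      note pD = tagged_division_ofD[OF p]
      have end_points: "K = {Inf K..Sup K} \<and> Inf K \<le> x \<and> x \<le> Sup K \<and> measure lborel K = Sup K - Inf K
          \<and> x \<in> {a..b}" if "(x, K) \<in> p" for x K
        using pD(2-4)[OF that] by auto
      define p1 where "p1 = {z\<in>p. fst z \<in> N}"
      define p2 where "p2 = {z\<in>p. fst z \<notin> N}"
      have pp: "p = p1 \<union> p2" "p1 \<inter> p2 = {}" by (auto simp: p1_def p2_def)
      have fin: "finite p1" "finite p2" "finite p" using pD(1) by (auto simp: p1_def p2_def)
      let ?t = "\<lambda>(x,K). measure lborel K *\<^sub>R v x - (u (Sup K) - u (Inf K))"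
      have eq: "(\<Sum>(x,K)\<in>p. measure lborel K *\<^sub>R v x) - (u b - u a) = (\<Sum>z\<in>p. ?t z)"
        unfolding additive_tagged_division_1[OF ab p, of u, symmetric] sum_subtractf[symmetric]
        by (simp only: case_prod_unfold)
      have p1: "cmod (\<Sum>z\<in>p1. ?t z) < e/2"
      proof -
        have ne: "(x, {}) \<notin> p" for x using pD(2)[of x "{}"] by auto
        have p1p: "p1 tagged_partial_division_of {a..b}"
          using p unfolding p1_def tagged_division_of_def
          by (rule tagged_partial_division_subset[OF conjunct1]) auto
        have div: "(snd ` p1) division_of \<Union>(snd ` p1)"
          by (rule partial_division_of_tagged_division[OF p1p])
        have sub: "\<Union>(snd ` p1) \<subseteq> {a..b}" using pD(3) by (fastforce simp: p1_def)
        have subU: "\<Union>(snd ` p1) \<subseteq> U"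
          using fine by (fastforce simp: p1_def fine_def \<gamma>_def)
        \<comment> \<open>The intervals with tags in \<open>N\<close> have disjoint interiors and lie in \<open>U\<close>, so their total length is less than \<open>\<delta>\<close>.\<close>
        have "(\<Sum>K\<in>snd ` p1. Sup K - Inf K) = (\<Sum>K\<in>snd ` p1. measure lebesgue K)"
          by (intro sum.cong refl) (metis division_member_real[OF div])
        also have "\<dots> = measure lebesgue (\<Union>(snd ` p1))" by (rule content_division[OF div])
        also have "\<dots> < \<delta>"
        proof -
          have "emeasure lebesgue (\<Union>(snd ` p1)) \<le> emeasure lebesgue U"
            by (rule emeasure_mono[OF subU Um])
          then have "emeasure lebesgue (\<Union>(snd ` p1)) < ennreal \<delta>" using U\<delta> by (rule le_less_trans)
          moreover have "\<Union>(snd ` p1) \<in> lmeasurable" using div by (rule lmeasurable_division)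
          ultimately show ?thesis using \<delta> by (simp add: emeasure_eq_measure2 ennreal_less_iff)
        qed
        finally have "(\<Sum>K\<in>snd ` p1. cmod (u (Sup K) - u (Inf K))) < e/2"
          by (rule ac'[OF div sub])
        \<comment> \<open>The case distinction is needed as \<open>Sup\<close> and \<open>Inf\<close> of the empty set are unspecified reals.\<close>
        also have "(\<Sum>K\<in>snd ` p1. cmod (u (Sup K) - u (Inf K)))
            = (\<Sum>K\<in>snd ` p1. if K = {} then 0 else cmod (u (Sup K) - u (Inf K)))"
          by (intro sum.cong refl) (auto simp: p1_def ne)
        also have "\<dots> = (\<Sum>(x,K)\<in>p1. if K = {} then 0 else cmod (u (Sup K) - u (Inf K)))"
          by (rule sum.over_tagged_division_lemma[OF tagged_partial_division_of_Union_self[OF p1p], symmetric])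
             (auto simp: box_real)
        also have "\<dots> = (\<Sum>z\<in>p1. cmod (?t z))"
          by (intro sum.cong refl) (auto simp: ne p1_def v_def norm_minus_commute)
        finally show ?thesis using norm_sum[of ?t p1] by linarith
      qed
      have p2: "cmod (\<Sum>z\<in>p2. ?t z) \<le> e/2"
      proof -
        have "cmod (?t z) \<le> \<epsilon> * (case z of (x,K) \<Rightarrow> Sup K - Inf K)" if z: "z \<in> p2" for z
        proof -
          obtain x K where zx: "z = (x, K)" by force
          have xK: "(x, K) \<in> p" "x \<notin> N" using z zx by (auto simp: p2_def)
          define c d where "c = Inf K" and "d = Sup K"
          have K: "K = {c..d}" "c \<le> x" "x \<le> d" "measure lborel K = d - c" "x \<in> {a..b} - N"
            using end_points[OF xK(1)] xK(2) by (auto simp: c_def d_def)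
          have "K \<subseteq> ball x (r x)" using fineD[OF fine xK(1)] xK(2) K(5) by (simp add: \<gamma>_def)
          moreover have "c \<in> K" "d \<in> K" using K(1-3) by auto
          ultimately have cd: "\<bar>c - x\<bar> < r x" "\<bar>d - x\<bar> < r x"
            by (auto simp: subset_iff dist_real_def abs_minus_commute)
          have "?t z = (u c - u x - (c - x) *\<^sub>R w x) - (u d - u x - (d - x) *\<^sub>R w x)"
            using xK(2) by (simp add: zx K(4) v_def c_def[symmetric] d_def[symmetric] algebra_simps)
          also have "cmod \<dots> \<le> cmod (u c - u x - (c - x) *\<^sub>R w x) + cmod (u d - u x - (d - x) *\<^sub>R w x)"
            by (rule norm_triangle_ineq4)
          also have "\<dots> \<le> \<epsilon> * \<bar>c - x\<bar> + \<epsilon> * \<bar>d - x\<bar>"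
            by (intro add_mono r(2) K(5) cd)
          also have "\<dots> = \<epsilon> * (d - c)" using K by (simp add: algebra_simps)
          finally show ?thesis by (simp add: zx c_def d_def)
        qed
        then have "cmod (\<Sum>z\<in>p2. ?t z) \<le> (\<Sum>z\<in>p2. \<epsilon> * (case z of (x,K) \<Rightarrow> Sup K - Inf K))"
          by (rule sum_norm_le)
        also have "\<dots> \<le> (\<Sum>z\<in>p. \<epsilon> * (case z of (x,K) \<Rightarrow> Sup K - Inf K))"
        proof (rule sum_mono2[OF fin(3)])
          show "p2 \<subseteq> p" using pp by auto
          show "0 \<le> \<epsilon> * (case z of (x,K) \<Rightarrow> Sup K - Inf K)" if "z \<in> p - p2" for z
          proof -
            obtain x K where zx: "z = (x, K)" by force
            then have "(x, K) \<in> p" using that by auto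
            from end_points[OF this] show ?thesis using \<epsilon> by (simp add: zx)
          qed
        qed
        also have "\<dots> = \<epsilon> * (b - a)"
          using additive_tagged_division_1[OF ab p, of "\<lambda>x. x"] by (simp add: sum_distrib_left[symmetric])
        also have "\<dots> \<le> \<epsilon> * (b - a + 1)" using \<epsilon> by (intro mult_left_mono) auto
        also have "\<dots> = e/2"
        proof -
          have "e / (2 * c) * c = e / 2" if "c > 0" for c :: real using that by simp
          from this[of "b - a + 1"] ab show ?thesis by (simp only: \<epsilon>_def)
        qed
        finally show ?thesis .
      qed
      have sp: "(\<Sum>z\<in>p. ?t z) = (\<Sum>z\<in>p1. ?t z) + (\<Sum>z\<in>p2. ?t z)"
        unfolding pp(1) by (rule sum.union_disjoint[OF fin(1,2) pp(2)])
      have "cmod (\<Sum>z\<in>p. ?t z) \<le> cmod (\<Sum>z\<in>p1. ?t z) + cmod (\<Sum>z\<in>p2. ?t z)"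
        unfolding sp by (rule norm_triangle_ineq)
      with p1 p2 have "cmod (\<Sum>z\<in>p. ?t z) < e" by linarith
      then show ?thesis by (rule ord_eq_less_trans[OF arg_cong[OF eq, of cmod]])
    qed
    show "\<exists>\<gamma>. gauge \<gamma> \<and> (\<forall>\<D>. \<D> tagged_division_of {a..b} \<and> \<gamma> fine \<D> \<longrightarrow>
        cmod ((\<Sum>(x,K)\<in>\<D>. measure lborel K *\<^sub>R v x) - (u b - u a)) < e)"
      by (rule exI[of _ \<gamma>], rule conjI[OF gauge], intro allI impI, erule conjE, rule close)
  qed
qed

lemma absolutely_continuous_on_imp_continuous_on:
  assumes "absolutely_continuous_on {a..b} f"
  shows "continuous_on {a..b} f"
  unfolding continuous_on_iff
proof (intro ballI allI impI)
  fix x e :: real assume x: "x \<in> {a..b}" and "e > 0"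
  then obtain \<delta> where \<delta>: "\<delta> > 0"
    and ac: "\<And>d. d division_of \<Union>d \<Longrightarrow> \<Union>d \<subseteq> {a..b} \<Longrightarrow> (\<Sum>K\<in>d. Sup K - Inf K) < \<delta> \<Longrightarrow>
        (\<Sum>K\<in>d. cmod (f (Sup K) - f (Inf K))) < e"
    using assms unfolding absolutely_continuous_on_def by meson
  have *: "dist (f s) (f t) < e" if "s \<le> t" "s \<in> {a..b}" "t \<in> {a..b}" "t - s < \<delta>" for s t
  proof -
    have "{cbox s t} division_of \<Union>{cbox s t}"
      using that division_of_self[of s t] by simp
    from ac[OF this] that show ?thesis by (simp add: dist_norm norm_minus_commute)
  qed
  show "\<exists>d>0. \<forall>x'\<in>{a..b}. dist x' x < d \<longrightarrow> dist (f x') (f x) < e"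
  proof (intro exI[of _ \<delta>] conjI ballI impI)
    fix y assume y: "y \<in> {a..b}" "dist y x < \<delta>"
    show "dist (f y) (f x) < e"
      using *[of x y] *[of y x] x y by (cases "x \<le> y") (auto simp: dist_real_def dist_commute)
  qed (rule \<delta>)
qed

text \<open>The product rule estimate with a bound for \<open>f\<close> on the compact interval.\<close>

lemma absolutely_continuous_on_sqnorm:
  assumes ac: "absolutely_continuous_on {a..b} f"
  shows "absolutely_continuous_on {a..b} (\<lambda>x. f x * cnj (f x))"
proof -
  have "bounded (f ` {a..b})"
    by (intro compact_imp_bounded compact_continuous_image absolutely_continuous_on_imp_continuous_on ac compact_Icc)
  then obtain B where B: "B > 0" "\<And>x. x \<in> {a..b} \<Longrightarrow> cmod (f x) \<le> B"
    unfolding bounded_pos by auto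
  have *: "cmod (f s * cnj (f s) - f t * cnj (f t)) \<le> 2 * B * cmod (f s - f t)"
    if "s \<in> {a..b}" "t \<in> {a..b}" for s t
  proof -
    have "f s * cnj (f s) - f t * cnj (f t) = f s * cnj (f s - f t) + (f s - f t) * cnj (f t)"
      by (simp add: algebra_simps)
    also have "cmod \<dots> \<le> cmod (f s) * cmod (f s - f t) + cmod (f s - f t) * cmod (f t)"
      by (metis complex_mod_cnj norm_mult norm_triangle_ineq)
    also have "\<dots> \<le> B * cmod (f s - f t) + cmod (f s - f t) * B"
      by (intro add_mono mult_right_mono mult_left_mono B that) auto
    finally show ?thesis by simp
  qed
  show ?thesis
    unfolding absolutely_continuous_on_def
  proof (intro allI impI)
    fix e :: real assume "e > 0"
    then have "e / (2 * B) > 0" using B by simp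
    then obtain \<delta> where \<delta>: "\<delta> > 0"
      and ac': "\<And>d. d division_of \<Union>d \<Longrightarrow> \<Union>d \<subseteq> {a..b} \<Longrightarrow> (\<Sum>K\<in>d. Sup K - Inf K) < \<delta> \<Longrightarrow>
        (\<Sum>K\<in>d. cmod (f (Sup K) - f (Inf K))) < e / (2 * B)"
      using ac unfolding absolutely_continuous_on_def by meson
    have "(\<Sum>K\<in>d. cmod (f (Sup K) * cnj (f (Sup K)) - f (Inf K) * cnj (f (Inf K)))) < e"
      if d: "d division_of \<Union>d" "\<Union>d \<subseteq> {a..b}" "(\<Sum>K\<in>d. Sup K - Inf K) < \<delta>" for d
    proof -
      have "(\<Sum>K\<in>d. cmod (f (Sup K) * cnj (f (Sup K)) - f (Inf K) * cnj (f (Inf K))))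
          \<le> (\<Sum>K\<in>d. 2 * B * cmod (f (Sup K) - f (Inf K)))"
      proof (intro sum_mono *)
        fix K assume "K \<in> d"
        then show "Sup K \<in> {a..b}" "Inf K \<in> {a..b}"
          using division_member_real[OF d(1)] d(2) by (meson subsetD)+
      qed
      also have "\<dots> = 2 * B * (\<Sum>K\<in>d. cmod (f (Sup K) - f (Inf K)))" by (simp add: sum_distrib_left)
      also have "\<dots> < 2 * B * (e / (2 * B))" using ac'[OF d] B(1) by (intro mult_strict_left_mono) auto
      also have "\<dots> = e" using B(1) by simp
      finally show ?thesis .
    qed
    with \<delta> show "\<exists>\<delta>>0. \<forall>d. d division_of \<Union>d \<and> \<Union>d \<subseteq> {a..b} \<and> (\<Sum>K\<in>d. Sup K - Inf K) < \<delta> \<longrightarrow>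
        (\<Sum>K\<in>d. cmod (f (Sup K) * cnj (f (Sup K)) - f (Inf K) * cnj (f (Inf K)))) < e"
      by blast
  qed
qed

lemma lipschitz_imp_locally_absolutely_continuous:
  assumes L: "\<And>x y. cmod (f x - f y) \<le> L * \<bar>x - y\<bar>"
  shows "locally_absolutely_continuous f"
  unfolding locally_absolutely_continuous_def absolutely_continuous_on_def
proof (intro allI impI)
  fix a b e :: real assume e: "e > 0"
  define C where "C = \<bar>L\<bar> + 1"
  have C: "C > 0" "\<And>x y. cmod (f x - f y) \<le> C * \<bar>x - y\<bar>"
  proof -
    show "cmod (f x - f y) \<le> C * \<bar>x - y\<bar>" for x y
      by (rule order_trans[OF L mult_right_mono]) (auto simp: C_def)
  qed (simp add: C_def)
  have "(\<Sum>K\<in>d. cmod (f (Sup K) - f (Inf K))) < e"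
    if d: "d division_of \<Union>d" "(\<Sum>K\<in>d. Sup K - Inf K) < e / C" for d
  proof -
    have "(\<Sum>K\<in>d. cmod (f (Sup K) - f (Inf K))) \<le> (\<Sum>K\<in>d. C * (Sup K - Inf K))"
    proof (rule sum_mono)
      fix K assume "K \<in> d"
      then have "Inf K \<le> Sup K" using division_member_real[OF d(1)] by meson
      then show "cmod (f (Sup K) - f (Inf K)) \<le> C * (Sup K - Inf K)"
        using C(2)[of "Sup K" "Inf K"] by simp
    qed
    also have "\<dots> = C * (\<Sum>K\<in>d. Sup K - Inf K)" by (simp add: sum_distrib_left)
    also have "\<dots> < C * (e / C)" using d(2) C(1) by (intro mult_strict_left_mono) auto
    also have "\<dots> = e" using C(1) by simp
    finally show ?thesis .
  qed
  moreover have "e / C > 0" using e C(1) by simp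
  ultimately show "\<exists>\<delta>>0. \<forall>d. d division_of \<Union>d \<and> \<Union>d \<subseteq> {a..b} \<and> (\<Sum>K\<in>d. Sup K - Inf K) < \<delta> \<longrightarrow>
        (\<Sum>K\<in>d. cmod (f (Sup K) - f (Inf K))) < e"
    by blast
qed

section \<open>The spectrum of the derivative operator\<close>

text \<open>An integrable function need not tend to zero, but if it has a limit then the limit is zero. This disposes of the boundary
values in the integration by parts.\<close>

lemma integrable_tendsto_at_top_zero:
  fixes q :: "real \<Rightarrow> 'a::{banach, second_countable_topology}"
  assumes q: "integrable lborel q" and lim: "(q \<longlongrightarrow> L) at_top"
  shows "L = 0"
proof (rule ccontr)
  assume L: "L \<noteq> 0"
  have "\<forall>\<^sub>F x in at_top. norm L / 2 < norm (q x)"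
    using order_tendstoD(1)[OF tendsto_norm[OF lim], of "norm L / 2"] L by simp
  then obtain N where N: "\<And>x. x \<ge> N \<Longrightarrow> norm L / 2 < norm (q x)"
    unfolding eventually_at_top_linorder by blast
  let ?I = "LINT x|lborel. norm (q x)"
  have bound: "real k * (norm L / 2) \<le> ?I" for k
  proof -
    have "(LINT x|lborel. indicator {N..N + real k} x *\<^sub>R (norm L / 2)) \<le> ?I"
    proof (rule integral_mono)
      show "indicator {N..N + real k} x *\<^sub>R (norm L / 2) \<le> norm (q x)" for x
        using N[of x] by (auto simp: indicator_def)
    qed (use q in auto)
    then show ?thesis by simp
  qed
  obtain k where "?I < real k * (norm L / 2)"
    using reals_Archimedean3[of "norm L / 2"] L by auto
  with bound[of k] show False by simp
qed

lemma set_integral_tendsto_integral: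
  fixes w :: "real \<Rightarrow> complex"
  assumes w: "integrable lebesgue w"
  shows "((\<lambda>R. LINT x:{-R..R}|lebesgue. w x) \<longlongrightarrow> (LINT x|lebesgue. w x)) at_top"
  unfolding set_lebesgue_integral_def
proof (rule integral_dominated_convergence_at_top)
  show "integrable lebesgue (\<lambda>x. cmod (w x))" using w by simp
  show "w \<in> borel_measurable lebesgue" using w by simp
  show "(\<lambda>x. indicator {-R..R} x *\<^sub>R w x) \<in> borel_measurable lebesgue" for R :: real
    using integrable_mult_indicator[OF _ w, of "{-R..R}"] by simp
  show "AE x in lebesgue. ((\<lambda>R::real. indicator {-R..R} x *\<^sub>R w x) \<longlongrightarrow> w x) at_top"
  proof (rule AE_I2)
    fix x :: real
    have "\<forall>\<^sub>F R::real in at_top. indicator {-R..R} x *\<^sub>R w x = w x"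
      using eventually_ge_at_top[of "\<bar>x\<bar>"] by eventually_elim (auto simp: indicator_def)
    then show "((\<lambda>R::real. indicator {-R..R} x *\<^sub>R w x) \<longlongrightarrow> w x) at_top"
      by (rule tendsto_eventually)
  qed
  show "\<forall>\<^sub>F R::real in at_top. AE x in lebesgue. norm (indicator {-R..R} x *\<^sub>R w x) \<le> cmod (w x)"
    by (auto simp: indicator_def)
qed

text \<open>Replaces the pointwise derivative used by the operator, which is arbitrary on a null set, by a representative in \<open>L2\<close>.\<close>

lemma dom_M_derivative:
  assumes y: "y \<in> dom_M"
  obtains z where "z \<in> L2" "AE x in lebesgue. (y has_vector_derivative z x) (at x)"
    "AE x in lebesgue. op_M y x = \<i> * z x"
proof -
  obtain z where z: "z \<in> L2" "AE x in lebesgue. (y has_vector_derivative z x) (at x)"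
    using y unfolding dom_M_def by blast
  have "AE x in lebesgue. op_M y x = \<i> * z x"
    using z(2) by eventually_elim (simp add: op_M_def vector_derivative_at)
  with z show ?thesis using that by blast
qed

text \<open>Symmetry of the operator: twice the real part is the integral of the derivative of \<open>\<bar>y\<bar>\<^sup>2\<close>. The integral over \<open>[-R, R]\<close>
is \<open>\<bar>y R\<bar>\<^sup>2 - \<bar>y (-R)\<bar>\<^sup>2\<close>, which as a function of \<open>R\<close> is integrable and convergent.\<close>

lemma Re_derivative_inner_zero:
  assumes y: "y \<in> dom_M" and z: "z \<in> L2"
    and der: "AE x in lebesgue. (y has_vector_derivative z x) (at x)"
  shows "Re (LINT x|lebesgue. z x * cnj (y x)) = 0"
proof -
  have yL: "y \<in> L2" and lac: "\<And>a b. absolutely_continuous_on {a..b} y"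
    using y unfolding dom_M_def locally_absolutely_continuous_def by auto
  define p where "p x = y x * cnj (y x)" for x
  define w where "w x = y x * cnj (z x) + z x * cnj (y x)" for x
  have w: "integrable lebesgue w"
    unfolding w_def[abs_def]
    by (intro Bochner_Integration.integrable_add L2_mult_integrable L2_cnj yL z)
  have "continuous_on UNIV y"
  proof (rule continuous_at_imp_continuous_on, rule ballI)
    fix x :: real
    have "continuous_on {x - 1<..<x + 1} y"
      by (rule continuous_on_subset[OF absolutely_continuous_on_imp_continuous_on[OF lac[of "x-1" "x+1"]]]) auto
    then show "isCont y x" by (simp add: continuous_on_eq_continuous_at)
  qed
  then have p_meas: "p \<in> borel_measurable borel"
    unfolding p_def[abs_def] by (intro borel_measurable_continuous_onI continuous_intros)
  have "integrable lebesgue p"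
    unfolding p_def[abs_def] by (intro L2_mult_integrable L2_cnj yL)
  then have p: "integrable lborel p"
    using p_meas by (simp add: integrable_completion)
  from lborel_integrable_real_affine[OF p, of "-1" 0]
  have q: "integrable lborel (\<lambda>R. p R - p (- R))" using p by simp
  have "(LINT x:{-R..R}|lebesgue. w x) = p R - p (- R)" if R: "R \<ge> 0" for R
  proof -
    obtain N where N: "N \<in> null_sets lebesgue" "\<And>x. x \<notin> N \<Longrightarrow> (y has_vector_derivative z x) (at x)"
      using der by (auto elim!: AE_E3)
    have "(w has_integral (p R - p (-R))) {-R..R}"
    proof (rule absolutely_continuous_on_FTC)
      show "absolutely_continuous_on {-R..R} p"
        unfolding p_def[abs_def] by (rule absolutely_continuous_on_sqnorm[OF lac])
      show "negligible N" using N by (simp add: negligible_iff_null_sets)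
      fix x assume "x \<in> {-R..R} - N"
      then have d: "(y has_vector_derivative z x) (at x)" using N by auto
      have "((\<lambda>x. cnj (y x)) has_vector_derivative cnj (z x)) (at x)"
        by (rule bounded_linear.has_vector_derivative[OF bounded_linear_cnj d])
      from has_vector_derivative_mult[OF d this]
      show "(p has_vector_derivative w x) (at x)"
        unfolding p_def[abs_def] w_def by simp
    qed (use R in auto)
    moreover have "set_integrable lebesgue {-R..R} w"
      unfolding set_integrable_def by (rule integrable_mult_indicator[OF _ w]) simp
    ultimately show ?thesis
      using set_lebesgue_integral_eq_integral(2) integral_unique by metis
  qed
  then have "\<forall>\<^sub>F R in at_top. (LINT x:{-R..R}|lebesgue. w x) = p R - p (- R)"
    by (rule eventually_mono[OF eventually_ge_at_top[of 0]])
  from Lim_transform_eventually[OF set_integral_tendsto_integral[OF w] this]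
  have "(LINT x|lebesgue. w x) = 0"
    by (rule integrable_tendsto_at_top_zero[OF q])
  moreover have "(LINT x|lebesgue. w x) = (LINT x|lebesgue. y x * cnj (z x)) + (LINT x|lebesgue. z x * cnj (y x))"
    unfolding w_def[abs_def]
    by (intro Bochner_Integration.integral_add L2_mult_integrable L2_cnj yL z)
  moreover have "(LINT x|lebesgue. y x * cnj (z x)) = cnj (LINT x|lebesgue. z x * cnj (y x))"
    by (subst Bochner_Integration.integral_cnj[symmetric]) (simp add: mult.commute)
  ultimately show ?thesis by (metis add.commute complex_add_cnj of_real_eq_0_iff mult_eq_0_iff zero_neq_numeral)
qed

text \<open>By symmetry, \<open>\<langle>(M - \<mu>) y, y\<rangle>\<close> has imaginary part \<open>- Im \<mu> \<parallel>y\<parallel>\<^sup>2\<close>.\<close>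

lemma Im_bound_dom_M:
  assumes y: "y \<in> dom_M"
  shows "\<bar>Im \<mu>\<bar> * L2_norm y \<le> L2_norm (\<lambda>x. op_M y x - \<mu> * y x)"
proof -
  have yL: "y \<in> L2" using y by (simp add: dom_M_def)
  obtain z where z: "z \<in> L2" and der: "AE x in lebesgue. (y has_vector_derivative z x) (at x)"
    and op: "AE x in lebesgue. op_M y x = \<i> * z x"
    using dom_M_derivative[OF y] .
  define g where "g x = \<i> * z x - \<mu> * y x" for x
  have g: "g \<in> L2" unfolding g_def[abs_def] by (intro L2_diff L2_scale z yL)
  have ae: "AE x in lebesgue. g x = op_M y x - \<mu> * y x"
    using op by eventually_elim (simp add: g_def)
  have gn: "L2_norm g = L2_norm (\<lambda>x. op_M y x - \<mu> * y x)"
    by (rule L2_norm_cong_AE[OF L2_measurable[OF g] borel_measurable_AE[OF L2_measurable[OF g] ae] ae])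
  have "(LINT x|lebesgue. g x * cnj (y x))
      = \<i> * (LINT x|lebesgue. z x * cnj (y x)) - \<mu> * (LINT x|lebesgue. y x * cnj (y x))"
  proof -
    have "(LINT x|lebesgue. g x * cnj (y x))
      = (LINT x|lebesgue. \<i> * (z x * cnj (y x)) - \<mu> * (y x * cnj (y x)))"
      by (simp add: g_def algebra_simps)
    also have "\<dots> = (LINT x|lebesgue. \<i> * (z x * cnj (y x))) - (LINT x|lebesgue. \<mu> * (y x * cnj (y x)))"
      by (intro Bochner_Integration.integral_diff integrable_mult_right L2_mult_integrable L2_cnj yL z)
    finally show ?thesis by simp
  qed
  also have "(LINT x|lebesgue. y x * cnj (y x)) = of_real ((L2_norm y)\<^sup>2)"
    unfolding L2_norm_sq integral_complex_of_real[symmetric]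
    by (intro Bochner_Integration.integral_cong) (simp_all only: complex_norm_square)
  finally have "Im (LINT x|lebesgue. g x * cnj (y x)) = - Im \<mu> * (L2_norm y)\<^sup>2"
    using Re_derivative_inner_zero[OF y z der] by (simp add: Im_complex_of_real del: of_real_power)
  then have "\<bar>Im \<mu>\<bar> * (L2_norm y)\<^sup>2 \<le> cmod (LINT x|lebesgue. g x * cnj (y x))"
    using abs_Im_le_cmod[of "LINT x|lebesgue. g x * cnj (y x)"] by (simp add: abs_mult)
  also have "\<dots> \<le> L2_norm g * L2_norm (\<lambda>x. cnj (y x))"
    by (intro L2_Cauchy_Schwarz g L2_cnj yL)
  also have "L2_norm (\<lambda>x. cnj (y x)) = L2_norm y" by (simp add: L2_norm_def)
  finally have "(\<bar>Im \<mu>\<bar> * L2_norm y) * L2_norm y \<le> L2_norm g * L2_norm y"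
    by (simp add: power2_eq_square)
  then have "L2_norm y \<noteq> 0 \<Longrightarrow> \<bar>Im \<mu>\<bar> * L2_norm y \<le> L2_norm g"
    by (metis L2_norm_pos mult_right_le_imp_le)
  then show ?thesis
    unfolding gn[symmetric] by (cases "L2_norm y = 0") simp_all
qed

lemma approx_eigenvalue_real:
  assumes "approx_eigenseq dom_M op_M \<mu> Y"
  shows "\<mu> \<in> \<real>"
proof -
  have Y: "\<And>n. Y n \<in> dom_M" "\<And>n. L2_norm (Y n) \<noteq> 0"
    and lim: "(\<lambda>n. L2_norm (\<lambda>x. op_M (Y n) x - \<mu> * Y n x) / L2_norm (Y n)) \<longlonglongrightarrow> 0"
    using assms by (auto simp: approx_eigenseq_def)
  have "\<bar>Im \<mu>\<bar> \<le> L2_norm (\<lambda>x. op_M (Y n) x - \<mu> * Y n x) / L2_norm (Y n)" for n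
  proof -
    have "L2_norm (Y n) > 0" by (rule L2_norm_pos[OF Y(2)])
    then show ?thesis using Im_bound_dom_M[OF Y(1)[of n], of \<mu>] by (simp add: pos_le_divide_eq)
  qed
  then have "\<bar>Im \<mu>\<bar> \<le> 0" by (intro LIMSEQ_le_const[OF lim]) auto
  then show ?thesis by (simp add: complex_is_Real_iff)
qed

lemma eigfun_has_vector_derivative:
  "(eigfun l has_vector_derivative - \<i> * of_real l * eigfun l x) (at x)"
proof -
  have "((\<lambda>w. exp (- \<i> * of_real l * w)) has_field_derivative - \<i> * of_real l * exp (- \<i> * of_real l * of_real x))
      (at (of_real x))"
    by (auto intro!: derivative_eq_intros)
  from has_vector_derivative_real_field[OF this] show ?thesis
    by (simp add: eigfun_def[abs_def] o_def)
qed

lemma cmod_eigfun [simp]: "cmod (eigfun l x) = 1"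
  by (simp add: eigfun_def)

lemma eigfun_continuous: "continuous_on A (eigfun l)"
  unfolding eigfun_def[abs_def] by (intro continuous_intros)

lemma eigfun_measurable [measurable]: "eigfun l \<in> borel_measurable borel"
  by (intro borel_measurable_continuous_onI eigfun_continuous)

lemma eigfun_not_L2: "eigfun l \<notin> L2"
proof
  assume "eigfun l \<in> L2"
  from L2_sq_integrable[OF this] have "integrable lebesgue (\<lambda>x::real. 1::real)" by simp
  then have "integrable lborel (\<lambda>x::real. 1::real)" by (subst (asm) integrable_completion) auto
  from integrable_tendsto_at_top_zero[OF this tendsto_const] show False by simp
qed

lemma not_AE_lebesgue_False: "\<not> (AE x::real in lebesgue. False)"
  by (simp add: eventually_False ae_filter_eq_bot_iff)

text \<open>The factor \<open>1 / (1 + t\<^sup>2)\<close> is used since its derivative is bounded by the factor itself, so that no norm needs to be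
computed.\<close>

definition damped_eigfun :: "real \<Rightarrow> nat \<Rightarrow> real \<Rightarrow> complex" where
  "damped_eigfun l n x = eigfun l x * of_real (inverse (1 + (x / real (Suc n))\<^sup>2))"

definition damped_eigfun' :: "real \<Rightarrow> nat \<Rightarrow> real \<Rightarrow> complex" where
  "damped_eigfun' l n x = - \<i> * of_real l * damped_eigfun l n x
     + damped_eigfun l n x * of_real (- (2 * (x / real (Suc n)) / (1 + (x / real (Suc n))\<^sup>2)) / real (Suc n))"

lemma damped_eigfun_has_vector_derivative:
  "(damped_eigfun l n has_vector_derivative damped_eigfun' l n x) (at x)"
proof -
  define c where "c = real (Suc n)"
  have c: "c > 0" by (simp add: c_def)
  have nz: "1 + (x/c)\<^sup>2 \<noteq> 0" by (simp add: add_nonneg_eq_0_iff)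
  have "((\<lambda>x. inverse (1 + (x / c)\<^sup>2)) has_real_derivative
      - (2 * (x / c) / c) * (inverse (1 + (x/c)\<^sup>2))\<^sup>2) (at x)"
    using c nz by (auto intro!: derivative_eq_intros simp: power2_eq_square divide_simps)
  then have "((\<lambda>x. of_real (inverse (1 + (x / c)\<^sup>2))) has_vector_derivative
      complex_of_real (- (2 * (x / c) / c) * (inverse (1 + (x/c)\<^sup>2))\<^sup>2)) (at x)"
    by (simp only: has_real_derivative_iff_has_vector_derivative has_vector_derivative_of_real)
  from has_vector_derivative_mult[OF eigfun_has_vector_derivative[of l x] this]
  show ?thesis
    unfolding damped_eigfun_def[abs_def] damped_eigfun'_def c_def[symmetric]
    by (simp add: power2_eq_square divide_inverse algebra_simps)
qed

text \<open>The damped waves are the approximate eigenfunctions: \<open>(M - l)\<close> applied to the \<open>n\<close>-th one is pointwise at most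
\<open>1 / (n + 1)\<close> times its modulus, because only the damping factor contributes.\<close>

lemma eigfun_continuum_eigenfunction: "continuum_eigenfunction dom_M op_M (of_real l) (eigfun l)"
proof -
  \<comment> \<open>Up to sign, the logarithmic derivative of the damping factor \<open>1 / (1 + t\<^sup>2)\<close>.\<close>
  have sm: "\<bar>2 * t / (1 + t\<^sup>2)\<bar> \<le> 1" for t :: real
  proof -
    have "0 \<le> (\<bar>t\<bar> - 1)\<^sup>2" by simp
    then have "2 * \<bar>t\<bar> \<le> 1 + t\<^sup>2" by (simp add: power2_diff)
    moreover have "0 < 1 + t\<^sup>2" by (simp add: add_pos_nonneg)
    ultimately show ?thesis by (simp add: abs_mult)
  qed
  have cont: "continuous_on UNIV (damped_eigfun l n)" for n
    using damped_eigfun_has_vector_derivative[of l n]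
    by (intro continuous_at_imp_continuous_on ballI) (rule has_vector_derivative_continuous)
  then have meas [measurable]: "damped_eigfun l n \<in> borel_measurable borel" for n
    by (rule borel_measurable_continuous_onI)
  have inv_le: "inverse (1 + t\<^sup>2) \<le> 1" "0 < inverse (1 + t\<^sup>2)" for t :: real
    by (auto simp: inverse_le_1_iff add_pos_nonneg)
  have cm: "cmod (damped_eigfun l n x) = inverse (1 + (x / real (Suc n))\<^sup>2)" for n x
    using inv_le(2)[of "x / real (Suc n)"] by (simp only: damped_eigfun_def norm_mult cmod_eigfun norm_of_real)
  have int1: "integrable lborel (\<lambda>x::real. inverse (1 + x\<^sup>2))"
    using integrable_inverse_1_plus_square by (simp add: set_integrable_def)
  have L2: "damped_eigfun l n \<in> L2" for n
  proof -
    have "integrable lborel (\<lambda>x::real. inverse (1 + (0 + inverse (real (Suc n)) * x)\<^sup>2))"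
      by (rule lborel_integrable_real_affine[OF int1]) simp
    then have "integrable lborel (\<lambda>x. inverse (1 + (x / real (Suc n))\<^sup>2))"
      by (simp add: divide_inverse mult.commute)
    then have "integrable lborel (\<lambda>x. (cmod (damped_eigfun l n x))\<^sup>2)"
    proof (rule Bochner_Integration.integrable_bound)
      have "t\<^sup>2 \<le> t" if "0 < t" "t \<le> 1" for t :: real
        using that by (simp add: power2_eq_square mult_left_le)
      then show "AE x in lborel. norm ((cmod (damped_eigfun l n x))\<^sup>2) \<le> norm (inverse (1 + (x / real (Suc n))\<^sup>2))"
        unfolding cm using inv_le by (intro AE_I2) (simp add: less_imp_le)
    qed measurable
    then show ?thesis by (simp add: L2_def integrable_completion measurable_completion)
  qed
  have meas' [measurable]: "damped_eigfun' l n \<in> borel_measurable borel" for n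
    unfolding damped_eigfun'_def[abs_def] by measurable
  have diff_le: "cmod (\<i> * damped_eigfun' l n x - of_real l * damped_eigfun l n x) \<le> 1 / real (Suc n) * cmod (damped_eigfun l n x)" for n x
  proof -
    define t where "t = x / real (Suc n)"
    have "\<i> * damped_eigfun' l n x - of_real l * damped_eigfun l n x
        = \<i> * (damped_eigfun l n x * of_real (- (2 * t / (1 + t\<^sup>2)) / real (Suc n)))"
      unfolding damped_eigfun'_def t_def[symmetric] by (simp add: algebra_simps)
    also have "cmod \<dots> = cmod (damped_eigfun l n x) * (\<bar>2 * t / (1 + t\<^sup>2)\<bar> / real (Suc n))"
      by (simp only: norm_mult norm_of_real norm_ii) (simp add: abs_mult)
    also have "\<dots> \<le> cmod (damped_eigfun l n x) * (1 / real (Suc n))"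
      by (intro mult_left_mono divide_right_mono sm) auto
    finally show ?thesis by (simp add: mult.commute)
  qed
  have damped_deriv_le: "cmod (damped_eigfun' l n x) \<le> (1 + \<bar>l\<bar>) * cmod (damped_eigfun l n x)" for n x
  proof -
    have "cmod (damped_eigfun' l n x) = cmod (\<i> * damped_eigfun' l n x)" by (simp add: norm_mult)
    also have "\<dots> \<le> cmod (\<i> * damped_eigfun' l n x - of_real l * damped_eigfun l n x) + cmod (of_real l * damped_eigfun l n x)"
      by (metis diff_add_cancel norm_triangle_ineq)
    also have "\<dots> \<le> 1 / real (Suc n) * cmod (damped_eigfun l n x) + \<bar>l\<bar> * cmod (damped_eigfun l n x)"
      using diff_le[of n x] by (simp add: norm_mult)
    also have "\<dots> \<le> 1 * cmod (damped_eigfun l n x) + \<bar>l\<bar> * cmod (damped_eigfun l n x)"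
      by (intro add_right_mono mult_right_mono) auto
    finally show ?thesis by (simp add: distrib_right)
  qed
  have L2': "damped_eigfun' l n \<in> L2" for n
    by (rule L2_dominated[OF L2[of n] _ damped_deriv_le]) (simp add: measurable_completion)
  have lac: "locally_absolutely_continuous (damped_eigfun l n)" for n
  proof (rule lipschitz_imp_locally_absolutely_continuous[of _ "1 + \<bar>l\<bar>"])
    fix x y
    have "cmod (damped_eigfun l n x - damped_eigfun l n y) \<le> (1 + \<bar>l\<bar>) * norm (x - y)"
    proof (rule differentiable_bound[of UNIV "damped_eigfun l n" "\<lambda>x h. h *\<^sub>R damped_eigfun' l n x"])
      show "(damped_eigfun l n has_derivative (\<lambda>h. h *\<^sub>R damped_eigfun' l n x)) (at x within UNIV)" for x
        using damped_eigfun_has_vector_derivative by (simp add: has_vector_derivative_def)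
      fix x
      have "cmod (damped_eigfun' l n x) \<le> (1 + \<bar>l\<bar>) * 1"
        by (rule order_trans[OF damped_deriv_le mult_left_mono]) (use cm inv_le in auto)
      then show "onorm (\<lambda>h. h *\<^sub>R damped_eigfun' l n x) \<le> 1 + \<bar>l\<bar>"
        by (intro onorm_le) (simp add: mult.commute mult_left_mono)
    qed auto
    then show "cmod (damped_eigfun l n x - damped_eigfun l n y) \<le> (1 + \<bar>l\<bar>) * \<bar>x - y\<bar>" by simp
  qed
  have dom: "damped_eigfun l n \<in> dom_M" for n
    unfolding dom_M_def using L2 L2' lac damped_eigfun_has_vector_derivative by blast
  have op: "op_M (damped_eigfun l n) x = \<i> * damped_eigfun' l n x" for n x
    by (simp add: op_M_def vector_derivative_at[OF damped_eigfun_has_vector_derivative])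
  have nz: "L2_norm (damped_eigfun l n) \<noteq> 0" for n
  proof
    assume "L2_norm (damped_eigfun l n) = 0"
    then have "AE x in lebesgue. damped_eigfun l n x = 0" using L2_norm_eq_0_iff[OF L2] by simp
    moreover have "damped_eigfun l n x \<noteq> 0" for x using cm[of n x] inv_le(2)[of "x / real (Suc n)"] by force
    ultimately show False using not_AE_lebesgue_False by simp
  qed
  have "approx_eigenseq dom_M op_M (of_real l) (damped_eigfun l)"
    unfolding approx_eigenseq_def op
  proof (intro conjI allI dom nz)
    have "norm (L2_norm (\<lambda>x. \<i> * damped_eigfun' l n x - of_real l * damped_eigfun l n x) / L2_norm (damped_eigfun l n)) \<le> 1 / real (Suc n)" for n
    proof -
      have "L2_norm (\<lambda>x. \<i> * damped_eigfun' l n x - of_real l * damped_eigfun l n x) \<le> 1 / real (Suc n) * L2_norm (damped_eigfun l n)"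
        by (rule L2_norm_mono[OF L2]) (use diff_le in \<open>auto intro!: measurable_completion\<close>)
      moreover have "L2_norm (damped_eigfun l n) > 0" by (rule L2_norm_pos[OF nz])
      ultimately show ?thesis by (simp add: pos_divide_le_eq)
    qed
    then show "(\<lambda>n. L2_norm (\<lambda>x. \<i> * damped_eigfun' l n x - of_real l * damped_eigfun l n x) / L2_norm (damped_eigfun l n)) \<longlonglongrightarrow> 0"
      by (intro Lim_null_comparison[OF _ LIMSEQ_Suc[OF lim_1_over_n]]) auto
  qed
  moreover have "(\<lambda>n. damped_eigfun l n x) \<longlonglongrightarrow> eigfun l x" for x
  proof -
    have "(\<lambda>n. x / real (Suc n)) \<longlonglongrightarrow> 0"
      using tendsto_mult_right_zero[OF LIMSEQ_Suc[OF lim_1_over_n], of x] by simp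
    then have "(\<lambda>n. damped_eigfun l n x) \<longlonglongrightarrow> eigfun l x * of_real (inverse (1 + 0\<^sup>2))"
      unfolding damped_eigfun_def by (intro tendsto_intros) auto
    then show ?thesis by simp
  qed
  moreover have "\<not> (AE x in lebesgue. eigfun l x = 0)"
    using not_AE_lebesgue_False by (simp add: eigfun_def)
  ultimately show ?thesis unfolding continuum_eigenfunction_def by blast
qed

lemma continuous_spectrum_M: "continuous_spectrum dom_M op_M = (\<real> :: complex set)"
proof
  show "continuous_spectrum dom_M op_M \<subseteq> \<real>"
    using approx_eigenvalue_real by (auto simp: continuous_spectrum_def continuum_eigenfunction_def)
  show "\<real> \<subseteq> continuous_spectrum dom_M op_M"
    using eigfun_continuum_eigenfunction by (auto simp: continuous_spectrum_def Reals_def)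
qed

section \<open>Fourier integrals and their duality\<close>

lemma sigma_finite_lebesgue: "sigma_finite_measure (lebesgue :: real measure)"
proof
  show "\<exists>A::real set set. countable A \<and> A \<subseteq> sets lebesgue \<and> \<Union>A = space lebesgue \<and> (\<forall>a\<in>A. emeasure lebesgue a \<noteq> \<infinity>)"
  proof (intro exI[of _ "range (\<lambda>n. {- real n..real n})"] conjI ballI)
    have "x \<in> \<Union>(range (\<lambda>n. {- real n..real n}))" for x :: real
    proof -
      obtain n where "\<bar>x\<bar> \<le> real n" using real_arch_simple by blast
      then show ?thesis by (auto intro!: exI[of _ n])
    qed
    then show "\<Union>(range (\<lambda>n. {- real n..real n})) = space lebesgue" by auto
  qed auto
qed

interpretation lebesgue: sigma_finite_measure "lebesgue :: real measure"
  by (rule sigma_finite_lebesgue)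

interpretation lebesgue_pair: pair_sigma_finite "lebesgue :: real measure" "lebesgue :: real measure" ..

lemma eigfun_commute: "eigfun l x = eigfun x l"
  by (simp add: eigfun_def mult_ac)

lemma eigfun_measurable_lebesgue [measurable]: "eigfun l \<in> borel_measurable lebesgue"
  by (simp add: measurable_completion)

lemma eigfun_pair_measurable [measurable]:
  "(\<lambda>p. eigfun (fst p) (snd p)) \<in> borel_measurable (lebesgue \<Otimes>\<^sub>M lebesgue)"
proof -
  have id: "(\<lambda>x::real. x) \<in> lebesgue \<rightarrow>\<^sub>M borel" by (simp add: measurable_completion)
  have [measurable]: "(fst :: real \<times> real \<Rightarrow> real) \<in> borel_measurable (lebesgue \<Otimes>\<^sub>M lebesgue)"
    "(snd :: real \<times> real \<Rightarrow> real) \<in> borel_measurable (lebesgue \<Otimes>\<^sub>M lebesgue)"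
    using measurable_compose[OF measurable_fst id] measurable_compose[OF measurable_snd id] by auto
  show ?thesis unfolding eigfun_def by measurable
qed

text \<open>The Fourier integral with the positive sign in the exponent, without the factor \<open>1 / (2 \<pi>)\<close>; this is the generalized
coefficient of \<open>f\<close> with respect to \<open>eigfun l\<close>.\<close>

definition FT :: "(real \<Rightarrow> complex) \<Rightarrow> real \<Rightarrow> complex" where
  "FT f l = (LINT x|lebesgue. f x * cnj (eigfun l x))"

definition IFT :: "(real \<Rightarrow> complex) \<Rightarrow> real \<Rightarrow> complex" where
  "IFT f x = (LINT l|lebesgue. f l * eigfun l x)"

text \<open>Reduces statements about the inverse transform to the forward one.\<close>

lemma IFT_eq_cnj_FT: "IFT f x = cnj (FT (\<lambda>l. cnj (f l)) x)"
  unfolding IFT_def FT_def Bochner_Integration.integral_cnj[symmetric] by (simp add: eigfun_commute)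

lemma integrable_mult_bounded:
  fixes f g :: "real \<Rightarrow> complex"
  assumes f: "integrable lebesgue f" and "g \<in> borel_measurable lebesgue" "\<And>x. cmod (g x) \<le> B"
  shows "integrable lebesgue (\<lambda>x. f x * g x)"
proof (rule Bochner_Integration.integrable_bound)
  note [measurable] = borel_measurable_integrable[OF f] assms(2)
  show "integrable lebesgue (\<lambda>x. B * cmod (f x))" using f by simp
  show "(\<lambda>x. f x * g x) \<in> borel_measurable lebesgue" by measurable
  have "B \<ge> 0" using norm_ge_zero assms(3) order_trans by blast
  then show "AE x in lebesgue. norm (f x * g x) \<le> norm (B * cmod (f x))"
    using mult_left_mono[OF assms(3) norm_ge_zero] by (intro AE_I2) (simp add: norm_mult abs_mult mult.commute)
qed

lemma FT_measurable [measurable]: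
  assumes [measurable]: "f \<in> borel_measurable lebesgue"
  shows "FT f \<in> borel_measurable lebesgue"
  unfolding FT_def[abs_def]
proof (rule lebesgue.borel_measurable_lebesgue_integral)
  have [measurable]: "(\<lambda>p. f (snd p)) \<in> borel_measurable (lebesgue \<Otimes>\<^sub>M lebesgue)"
    by (rule measurable_compose[OF measurable_snd assms])
  show "(\<lambda>(l, x). f x * cnj (eigfun l x)) \<in> borel_measurable (lebesgue \<Otimes>\<^sub>M lebesgue)"
    unfolding case_prod_unfold by measurable
qed

lemma FT_bound:
  assumes "integrable lebesgue f"
  shows "cmod (FT f l) \<le> (LINT x|lebesgue. cmod (f x))"
  unfolding FT_def by (rule integral_norm_bound[THEN order_trans]) (simp add: norm_mult)

text \<open>Fubini's theorem, and symmetry of the kernel \<open>exp (i l x)\<close> in \<open>l\<close> and \<open>x\<close>.\<close>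

lemma FT_duality:
  assumes f: "integrable lebesgue f" and g: "integrable lebesgue g"
  shows "(LINT l|lebesgue. FT f l * g l) = (LINT x|lebesgue. f x * FT g x)"
proof -
  note [measurable] = borel_measurable_integrable[OF f] borel_measurable_integrable[OF g]
  let ?k = "\<lambda>l x. g l * (f x * cnj (eigfun l x))"
  have [measurable]: "(\<lambda>p. f (snd p)) \<in> borel_measurable (lebesgue \<Otimes>\<^sub>M lebesgue)"
    "(\<lambda>p. g (fst p)) \<in> borel_measurable (lebesgue \<Otimes>\<^sub>M lebesgue)"
    by (rule measurable_compose[OF measurable_snd borel_measurable_integrable[OF f]]
        measurable_compose[OF measurable_fst borel_measurable_integrable[OF g]])+
  have k: "integrable (lebesgue \<Otimes>\<^sub>M lebesgue) (\<lambda>(l, x). ?k l x)"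
  proof (rule lebesgue_pair.Fubini_integrable)
    show "(\<lambda>(l, x). ?k l x) \<in> borel_measurable (lebesgue \<Otimes>\<^sub>M lebesgue)"
      unfolding case_prod_unfold by measurable
    have "(LINT x|lebesgue. norm (case (l, x) of (l, x) \<Rightarrow> ?k l x)) = cmod (g l) * (LINT x|lebesgue. cmod (f x))" for l
      by (simp add: norm_mult)
    then show "integrable lebesgue (\<lambda>l. LINT x|lebesgue. norm (case (l, x) of (l, x) \<Rightarrow> ?k l x))"
      using g by simp
    have "integrable lebesgue (\<lambda>x. f x * cnj (eigfun l x))" for l
      by (rule integrable_mult_bounded[OF f, of _ 1]) auto
    then show "AE l in lebesgue. integrable lebesgue (\<lambda>x. case (l, x) of (l, x) \<Rightarrow> ?k l x)"
      by simp
  qed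
  have "(LINT l|lebesgue. FT f l * g l) = (LINT l|lebesgue. LINT x|lebesgue. ?k l x)"
    by (simp add: FT_def mult.commute)
  also have "\<dots> = (LINT x|lebesgue. LINT l|lebesgue. ?k l x)"
    using lebesgue_pair.Fubini_integral[OF k] by simp
  also have "\<dots> = (LINT x|lebesgue. f x * FT g x)"
    unfolding FT_def integral_mult_right_zero[symmetric]
    by (intro Bochner_Integration.integral_cong refl) (simp add: eigfun_commute mult_ac)
  finally show ?thesis .
qed

lemma IFT_duality:
  assumes f: "integrable lebesgue f" and g: "integrable lebesgue g"
  shows "(LINT l|lebesgue. IFT f l * g l) = (LINT x|lebesgue. f x * IFT g x)"
proof -
  have "(LINT l|lebesgue. IFT f l * g l) = cnj (LINT l|lebesgue. FT (\<lambda>x. cnj (f x)) l * cnj (g l))"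
    unfolding IFT_eq_cnj_FT Bochner_Integration.integral_cnj[symmetric] by simp
  also have "\<dots> = cnj (LINT x|lebesgue. cnj (f x) * FT (\<lambda>x. cnj (g x)) x)"
    using f g by (subst FT_duality) auto
  also have "\<dots> = (LINT x|lebesgue. f x * IFT g x)"
    unfolding IFT_eq_cnj_FT Bochner_Integration.integral_cnj[symmetric] by simp
  finally show ?thesis .
qed

text \<open>Rescaled form of the characteristic function of the standard normal distribution.\<close>

lemma normal_density_FT:
  assumes s: "\<sigma> > 0"
  shows "FT (\<lambda>l. of_real (normal_density 0 \<sigma> l)) t = of_real (exp (- (\<sigma> * t)\<^sup>2 / 2))"
proof -
  let ?h = "\<lambda>l. complex_of_real (normal_density 0 \<sigma> l) * cnj (eigfun t l)"
  have "FT (\<lambda>l. of_real (normal_density 0 \<sigma> l)) t = (LINT l|lborel. ?h l)"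
    unfolding FT_def by (rule integral_completion) measurable
  also have "\<dots> = \<bar>\<sigma>\<bar> *\<^sub>R (LINT x|lborel. ?h (0 + \<sigma> * x))"
    by (rule lborel_integral_real_affine) (use s in simp)
  also have "\<dots> = (LINT x|lborel. std_normal_density x *\<^sub>R iexp ((\<sigma> * t) * x))"
  proof -
    have "\<sigma> *\<^sub>R ?h (0 + \<sigma> * x) = std_normal_density x *\<^sub>R iexp ((\<sigma> * t) * x)" for x
    proof -
      have "\<sigma> * normal_density 0 \<sigma> (\<sigma> * x) = std_normal_density x"
        using s by (simp add: normal_density_def real_sqrt_mult power_mult_distrib)
      moreover have "cnj (eigfun t (\<sigma> * x)) = iexp ((\<sigma> * t) * x)"
        by (simp add: eigfun_def exp_cnj mult_ac)
      ultimately show ?thesis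
        by (simp add: scaleR_conv_of_real mult.assoc[symmetric] del: of_real_mult flip: of_real_mult)
    qed
    then show ?thesis by (simp only: abs_of_pos[OF s] integral_scaleR_right[symmetric])
  qed
  also have "\<dots> = char std_normal_distribution (\<sigma> * t)"
    unfolding char_def by (subst integral_density) auto
  finally show ?thesis by (simp add: char_std_normal_distribution)
qed

section \<open>The Bessel inequality for the Fourier integral\<close>

lemma normal_density_swap: "normal_density x \<sigma> y = normal_density y \<sigma> x"
  by (simp add: normal_density_def power2_commute)

lemma nn_integral_normal_density:
  assumes "\<sigma> > 0"
  shows "(\<integral>\<^sup>+y. ennreal (normal_density x \<sigma> y) \<partial>lebesgue) = 1"
proof -
  have "(\<integral>\<^sup>+y. ennreal (normal_density x \<sigma> y) \<partial>lebesgue) = (\<integral>\<^sup>+y. ennreal (normal_density x \<sigma> y) \<partial>lborel)"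
    by (rule nn_integral_completion)
  also have "\<dots> = 1"
    using assms by (subst nn_integral_eq_integral) auto
  finally show ?thesis .
qed

lemma normal_density_pair_measurable:
  "(\<lambda>p. normal_density (fst p) \<sigma> (snd p)) \<in> borel_measurable (lebesgue \<Otimes>\<^sub>M lebesgue)"
proof -
  have id: "(\<lambda>x::real. x) \<in> lebesgue \<rightarrow>\<^sub>M borel" by (simp add: measurable_completion)
  have [measurable]: "(fst :: real \<times> real \<Rightarrow> real) \<in> borel_measurable (lebesgue \<Otimes>\<^sub>M lebesgue)"
    "(snd :: real \<times> real \<Rightarrow> real) \<in> borel_measurable (lebesgue \<Otimes>\<^sub>M lebesgue)"
    using measurable_compose[OF measurable_fst id] measurable_compose[OF measurable_snd id] by auto
  show ?thesis unfolding normal_density_def by measurable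
qed

text \<open>The Schur test: \<open>\<bar>f x f y\<bar>\<close> is at most the mean of \<open>\<bar>f x\<bar>\<^sup>2\<close> and \<open>\<bar>f y\<bar>\<^sup>2\<close>, and the kernel has mass \<open>1\<close> in each variable.\<close>

lemma gaussian_Schur_bound:
  assumes f: "f \<in> L2" and s: "\<sigma> > 0"
  shows "(\<integral>\<^sup>+x. \<integral>\<^sup>+y. ennreal (cmod (f x) * cmod (f y) * normal_density x \<sigma> y) \<partial>lebesgue \<partial>lebesgue)
    \<le> ennreal ((L2_norm f)\<^sup>2)"
proof -
  note [measurable] = L2_measurable[OF f] normal_density_pair_measurable[of \<sigma>]
  have [measurable]: "(\<lambda>p. f (snd p)) \<in> borel_measurable (lebesgue \<Otimes>\<^sub>M lebesgue)"
    "(\<lambda>p. f (fst p)) \<in> borel_measurable (lebesgue \<Otimes>\<^sub>M lebesgue)"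
    by (rule measurable_compose[OF measurable_snd L2_measurable[OF f]]
        measurable_compose[OF measurable_fst L2_measurable[OF f]])+
  have nd [measurable]: "normal_density x \<sigma> \<in> borel_measurable lebesgue" for x
    by (simp add: measurable_completion)
  have nd' [measurable]: "(\<lambda>x. normal_density x \<sigma> y) \<in> borel_measurable lebesgue" for y
    by (rule measurable_cong[THEN iffD1, OF _ nd[of y]]) (rule normal_density_swap)
  define A where "A x y = ennreal ((cmod (f x))\<^sup>2 * normal_density x \<sigma> y)" for x y
  have [measurable]: "(\<lambda>p. A (fst p) (snd p)) \<in> borel_measurable (lebesgue \<Otimes>\<^sub>M lebesgue)"
    unfolding A_def by measurable
  have [measurable]: "A x \<in> borel_measurable lebesgue" "(\<lambda>x. A x y) \<in> borel_measurable lebesgue" for x y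
    unfolding A_def[abs_def] by measurable
  have meas2 [measurable]: "(\<lambda>x. \<integral>\<^sup>+y. A x y \<partial>lebesgue) \<in> borel_measurable lebesgue"
    "(\<lambda>x. \<integral>\<^sup>+y. A y x \<partial>lebesgue) \<in> borel_measurable lebesgue"
  proof -
    show "(\<lambda>x. \<integral>\<^sup>+y. A x y \<partial>lebesgue) \<in> borel_measurable lebesgue"
      by (rule lebesgue.borel_measurable_nn_integral) (unfold case_prod_unfold, measurable)
    have "(\<lambda>p. A (snd p) (fst p)) \<in> borel_measurable (lebesgue \<Otimes>\<^sub>M lebesgue)"
      using measurable_pair_swap[of "\<lambda>p. A (fst p) (snd p)" lebesgue lebesgue borel]
      by (simp add: case_prod_unfold)
    then show "(\<lambda>x. \<integral>\<^sup>+y. A y x \<partial>lebesgue) \<in> borel_measurable lebesgue"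
      by (intro lebesgue.borel_measurable_nn_integral) (simp add: case_prod_unfold)
  qed
  have A1: "(\<integral>\<^sup>+y. A x y \<partial>lebesgue) = ennreal ((cmod (f x))\<^sup>2)" for x
    unfolding A_def using nn_integral_normal_density[OF s, of x]
    by (simp add: ennreal_mult nn_integral_cmult)
  have A2: "(\<integral>\<^sup>+x. \<integral>\<^sup>+y. A x y \<partial>lebesgue \<partial>lebesgue) = ennreal ((L2_norm f)\<^sup>2)"
    unfolding A1 L2_norm_sq by (rule nn_integral_eq_integral[OF L2_sq_integrable[OF f]]) simp
  have A3: "(\<integral>\<^sup>+x. \<integral>\<^sup>+y. A y x \<partial>lebesgue \<partial>lebesgue) = ennreal ((L2_norm f)\<^sup>2)"
    unfolding A2[symmetric]
    by (rule lebesgue_pair.Fubini') (simp add: case_prod_unfold)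
  have "(\<integral>\<^sup>+x. \<integral>\<^sup>+y. ennreal (cmod (f x) * cmod (f y) * normal_density x \<sigma> y) \<partial>lebesgue \<partial>lebesgue)
     \<le> (\<integral>\<^sup>+x. \<integral>\<^sup>+y. ennreal (1/2) * A x y + ennreal (1/2) * A y x \<partial>lebesgue \<partial>lebesgue)"
  proof (intro nn_integral_mono)
    fix x y
    have "cmod (f x) * cmod (f y) * normal_density x \<sigma> y
        \<le> ((cmod (f x))\<^sup>2 / 2 + (cmod (f y))\<^sup>2 / 2) * normal_density x \<sigma> y"
      using sum_squares_bound[of "cmod (f x)" "cmod (f y)"] by (intro mult_right_mono) auto
    then have "ennreal (cmod (f x) * cmod (f y) * normal_density x \<sigma> y)
      \<le> ennreal (1/2 * ((cmod (f x))\<^sup>2 * normal_density x \<sigma> y) + 1/2 * ((cmod (f y))\<^sup>2 * normal_density y \<sigma> x))"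
      by (intro ennreal_leI) (simp add: normal_density_swap[of y \<sigma> x] algebra_simps)
    then show "ennreal (cmod (f x) * cmod (f y) * normal_density x \<sigma> y) \<le> ennreal (1/2) * A x y + ennreal (1/2) * A y x"
      by (simp only: A_def ennreal_plus ennreal_mult' mult_nonneg_nonneg normal_density_nonneg zero_le_power2 zero_le_divide_1_iff zero_le_numeral)
  qed
  also have "\<dots> = (\<integral>\<^sup>+x. ennreal (1/2) * (\<integral>\<^sup>+y. A x y \<partial>lebesgue) + ennreal (1/2) * (\<integral>\<^sup>+y. A y x \<partial>lebesgue) \<partial>lebesgue)"
    by (intro nn_integral_cong) (simp add: nn_integral_add nn_integral_cmult)
  also have "\<dots> = ennreal (1/2) * ennreal ((L2_norm f)\<^sup>2) + ennreal (1/2) * ennreal ((L2_norm f)\<^sup>2)"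
    unfolding A2[symmetric]
    by (simp add: nn_integral_add nn_integral_cmult A3 A2)
  also have "\<dots> = ennreal ((L2_norm f)\<^sup>2)"
    by (simp only: ennreal_mult'[symmetric] ennreal_plus[symmetric] zero_le_divide_1_iff zero_le_numeral
        mult_nonneg_nonneg zero_le_power2) simp
  finally show ?thesis .
qed

text \<open>Two applications of duality move the transforms onto the Gaussian weight of width \<open>\<sigma>\<close>, which becomes a Gaussian of width
\<open>1 / \<sigma>\<close> and mass \<open>sqrt (2 \<pi>) / \<sigma>\<close>. The Gaussian makes every integral absolutely convergent, although \<open>FT f\<close> is only
known to be bounded.\<close>

lemma gaussian_mean_FT:
  assumes f: "f \<in> L2" and fi: "integrable lebesgue f" and s: "\<sigma> > 0"
  shows "(LINT l|lebesgue. normal_density 0 \<sigma> l * (cmod (FT f l))\<^sup>2) \<le> sqrt (2 * pi) / \<sigma> * (L2_norm f)\<^sup>2"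
proof -
  note [measurable] = L2_measurable[OF f]
  let ?w = "normal_density 0 \<sigma>"
  have w: "integrable lebesgue (\<lambda>l. complex_of_real (?w l))"
    using integrable_normal_density[OF s, of 0] by (intro integrable_of_real) (simp add: integrable_completion)
  let ?C = "LINT x|lebesgue. cmod (f x)"
  let ?g = "\<lambda>l. of_real (?w l) * cnj (FT f l)"
  have g: "integrable lebesgue ?g"
    by (rule integrable_mult_bounded[OF w, of _ ?C]) (use FT_bound[OF fi] in auto)
  have FTg: "FT ?g x = cnj (LINT y|lebesgue. f y * of_real (exp (- (\<sigma> * (y - x))\<^sup>2 / 2)))" for x
  proof -
    let ?e = "\<lambda>l. complex_of_real (?w l) * eigfun x l"
    have e: "integrable lebesgue ?e"
      by (rule integrable_mult_bounded[OF w, of _ 1]) auto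
    \<comment> \<open>Modulating the Gaussian translates its transform.\<close>
    have FTe: "FT ?e y = of_real (exp (- (\<sigma> * (y - x))\<^sup>2 / 2))" for y
    proof -
      have "eigfun x l * cnj (eigfun y l) = cnj (eigfun (y - x) l)" for l
        by (simp add: eigfun_def exp_cnj exp_add[symmetric] algebra_simps)
      then have "FT ?e y = FT (\<lambda>l. of_real (?w l)) (y - x)"
        unfolding FT_def by (simp add: mult.assoc)
      then show ?thesis using normal_density_FT[OF s] by simp
    qed
    have "FT ?g x = cnj (LINT l|lebesgue. FT f l * ?e l)"
      unfolding FT_def[of ?g] Bochner_Integration.integral_cnj[symmetric] by (simp add: mult_ac)
    also have "(LINT l|lebesgue. FT f l * ?e l) = (LINT y|lebesgue. f y * of_real (exp (- (\<sigma> * (y - x))\<^sup>2 / 2)))"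
      by (simp add: FT_duality[OF fi e] FTe)
    finally show ?thesis .
  qed
  \<comment> \<open>The transformed Gaussian is a multiple of the probability density of width \<open>1 / \<sigma>\<close>.\<close>
  have nd: "exp (- (\<sigma> * (y - x))\<^sup>2 / 2) = sqrt (2 * pi) / \<sigma> * normal_density x (1 / \<sigma>) y" for x y
    using s by (simp add: normal_density_def real_sqrt_divide power_mult_distrib power_divide)
  let ?I = "LINT l|lebesgue. ?w l * (cmod (FT f l))\<^sup>2"
  have "complex_of_real ?I = (LINT l|lebesgue. FT f l * ?g l)"
    unfolding integral_complex_of_real[symmetric] of_real_mult complex_norm_square by (simp add: mult_ac)
  also have "\<dots> = (LINT x|lebesgue. f x * FT ?g x)"
    by (rule FT_duality[OF fi g])
  finally have "ennreal (norm (complex_of_real ?I)) = ennreal (norm (LINT x|lebesgue. f x * FT ?g x))" by simp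
  also have "\<dots> \<le> (\<integral>\<^sup>+x. ennreal (norm (f x * FT ?g x)) \<partial>lebesgue)"
    by (rule integral_norm_bound_ennreal, rule integrable_mult_bounded[OF fi, of _ "LINT l|lebesgue. cmod (?g l)"])
       (use borel_measurable_integrable[OF g] FT_bound[OF g] in auto)
  also have "\<dots> \<le> (\<integral>\<^sup>+x. ennreal (sqrt (2 * pi) / \<sigma>) *
      (\<integral>\<^sup>+y. ennreal (cmod (f x) * cmod (f y) * normal_density x (1 / \<sigma>) y) \<partial>lebesgue) \<partial>lebesgue)"
  proof (rule nn_integral_mono)
    fix x
    have m [measurable]: "normal_density x (1 / \<sigma>) \<in> borel_measurable lebesgue"
      by (simp add: measurable_completion)
    have i: "integrable lebesgue (\<lambda>y. f y * of_real (exp (- (\<sigma> * (y - x))\<^sup>2 / 2)))"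
    proof (rule integrable_mult_bounded[OF fi, of _ 1])
      show "(\<lambda>y. complex_of_real (exp (- (\<sigma> * (y - x))\<^sup>2 / 2))) \<in> borel_measurable lebesgue"
        unfolding nd by measurable
    qed simp
    have "ennreal (norm (f x * FT ?g x)) = ennreal (cmod (f x)) * ennreal (norm (LINT y|lebesgue. f y * of_real (exp (- (\<sigma> * (y - x))\<^sup>2 / 2))))"
      unfolding FTg by (simp add: norm_mult ennreal_mult)
    also have "\<dots> \<le> ennreal (cmod (f x)) * (\<integral>\<^sup>+y. ennreal (norm (f y * of_real (exp (- (\<sigma> * (y - x))\<^sup>2 / 2)))) \<partial>lebesgue)"
      by (intro mult_left_mono integral_norm_bound_ennreal i) auto
    also have "\<dots> = (\<integral>\<^sup>+y. ennreal (cmod (f x)) * ennreal (norm (f y * of_real (exp (- (\<sigma> * (y - x))\<^sup>2 / 2)))) \<partial>lebesgue)"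
      using borel_measurable_integrable[OF i] by (intro nn_integral_cmult[symmetric]) auto
    also have "\<dots> = (\<integral>\<^sup>+y. ennreal (sqrt (2 * pi) / \<sigma>) * ennreal (cmod (f x) * cmod (f y) * normal_density x (1 / \<sigma>) y) \<partial>lebesgue)"
    proof (rule nn_integral_cong)
      fix y
      have "norm (f y * of_real (exp (- (\<sigma> * (y - x))\<^sup>2 / 2))) = cmod (f y) * (sqrt (2 * pi) / \<sigma> * normal_density x (1 / \<sigma>) y)"
        unfolding norm_mult norm_of_real nd using s by (simp add: abs_mult)
      then show "ennreal (cmod (f x)) * ennreal (norm (f y * of_real (exp (- (\<sigma> * (y - x))\<^sup>2 / 2))))
          = ennreal (sqrt (2 * pi) / \<sigma>) * ennreal (cmod (f x) * cmod (f y) * normal_density x (1 / \<sigma>) y)"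
        using s by (simp add: ennreal_mult[symmetric] mult_ac)
    qed
    also have "\<dots> = ennreal (sqrt (2 * pi) / \<sigma>) * (\<integral>\<^sup>+y. ennreal (cmod (f x) * cmod (f y) * normal_density x (1 / \<sigma>) y) \<partial>lebesgue)"
      by (rule nn_integral_cmult) measurable
    finally show "ennreal (norm (f x * FT ?g x)) \<le> ennreal (sqrt (2 * pi) / \<sigma>) *
      (\<integral>\<^sup>+y. ennreal (cmod (f x) * cmod (f y) * normal_density x (1 / \<sigma>) y) \<partial>lebesgue)" .
  qed
  also have "\<dots> = ennreal (sqrt (2 * pi) / \<sigma>) * (\<integral>\<^sup>+x. (\<integral>\<^sup>+y. ennreal (cmod (f x) * cmod (f y) * normal_density x (1 / \<sigma>) y) \<partial>lebesgue) \<partial>lebesgue)"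
  proof (rule nn_integral_cmult, rule lebesgue.borel_measurable_nn_integral)
    note [measurable] = measurable_compose[OF measurable_snd L2_measurable[OF f]]
        measurable_compose[OF measurable_fst L2_measurable[OF f]] normal_density_pair_measurable[of "1 / \<sigma>"]
    show "(\<lambda>(x, y). ennreal (cmod (f x) * cmod (f y) * normal_density x (1 / \<sigma>) y)) \<in> borel_measurable (lebesgue \<Otimes>\<^sub>M lebesgue)"
      unfolding case_prod_unfold by measurable
  qed
  also have "\<dots> \<le> ennreal (sqrt (2 * pi) / \<sigma>) * ennreal ((L2_norm f)\<^sup>2)"
    by (intro mult_left_mono gaussian_Schur_bound f) (use s in auto)
  also have "\<dots> = ennreal (sqrt (2 * pi) / \<sigma> * (L2_norm f)\<^sup>2)"
    by (rule ennreal_mult[symmetric]) (use s in auto)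
  finally have "norm (complex_of_real ?I) \<le> sqrt (2 * pi) / \<sigma> * (L2_norm f)\<^sup>2"
    using s by (subst (asm) ennreal_le_iff) auto
  then show ?thesis by simp
qed

text \<open>The Gaussian weights, normalised to the value \<open>1\<close> at the origin, increase to \<open>1\<close> as their width grows, and the weighted
integrals are bounded by \<open>2 \<pi> \<parallel>f\<parallel>\<^sup>2\<close> independently of the width.\<close>

lemma FT_L2:
  assumes f: "f \<in> L2" and fi: "integrable lebesgue f"
  shows "FT f \<in> L2 \<and> L2_norm (FT f) \<le> sqrt (2 * pi) * L2_norm f"
proof -
  note [measurable] = L2_measurable[OF f]
  define u where "u n l = exp (- (l / real (Suc n))\<^sup>2 / 2) * (cmod (FT f l))\<^sup>2" for n l
  have id [measurable]: "(\<lambda>x::real. x) \<in> lebesgue \<rightarrow>\<^sub>M borel" by (simp add: measurable_completion)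
  have [measurable]: "u n \<in> borel_measurable lebesgue" for n
    unfolding u_def[abs_def] by measurable
  have u: "(\<integral>\<^sup>+l. ennreal (u n l) \<partial>lebesgue) \<le> ennreal (2 * pi * (L2_norm f)\<^sup>2)" for n
  proof -
    define \<sigma> where "\<sigma> = real (Suc n)"
    have s: "\<sigma> > 0" by (simp add: \<sigma>_def)
    have eq: "u n l = \<sigma> * sqrt (2 * pi) * (normal_density 0 \<sigma> l * (cmod (FT f l))\<^sup>2)" for l
      using s unfolding u_def \<sigma>_def[symmetric]
      by (simp add: normal_density_def real_sqrt_mult power_divide)
    have w: "integrable lebesgue (\<lambda>l. complex_of_real (normal_density 0 \<sigma> l))"
      using integrable_normal_density[OF s, of 0] by (intro integrable_of_real) (simp add: integrable_completion)
    have "integrable lebesgue (\<lambda>l. complex_of_real (normal_density 0 \<sigma> l) * of_real ((cmod (FT f l))\<^sup>2))"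
      by (rule integrable_mult_bounded[OF w, of _ "(LINT x|lebesgue. cmod (f x))\<^sup>2"])
         (use FT_bound[OF fi] in \<open>auto simp: norm_power intro: power_mono\<close>)
    then have i: "integrable lebesgue (\<lambda>l. normal_density 0 \<sigma> l * (cmod (FT f l))\<^sup>2)"
      unfolding of_real_mult[symmetric] complex_of_real_integrable_eq .
    have "(\<integral>\<^sup>+l. ennreal (u n l) \<partial>lebesgue) = ennreal (\<sigma> * sqrt (2 * pi) * (LINT l|lebesgue. normal_density 0 \<sigma> l * (cmod (FT f l))\<^sup>2))"
      unfolding eq using i s by (subst nn_integral_eq_integral) auto
    also have "\<dots> \<le> ennreal (\<sigma> * sqrt (2 * pi) * (sqrt (2 * pi) / \<sigma> * (L2_norm f)\<^sup>2))"
      by (intro ennreal_leI mult_left_mono gaussian_mean_FT f fi s) (use s in auto)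
    also have "\<sigma> * sqrt (2 * pi) * (sqrt (2 * pi) / \<sigma> * (L2_norm f)\<^sup>2) = 2 * pi * (L2_norm f)\<^sup>2"
      using s by simp
    finally show ?thesis .
  qed
  have "(\<integral>\<^sup>+l. ennreal ((cmod (FT f l))\<^sup>2) \<partial>lebesgue) = (\<integral>\<^sup>+l. liminf (\<lambda>n. ennreal (u n l)) \<partial>lebesgue)"
  proof (rule nn_integral_cong)
    fix l
    have "(\<lambda>n. l / real (Suc n)) \<longlonglongrightarrow> 0"
      using tendsto_mult_right_zero[OF LIMSEQ_Suc[OF lim_1_over_n], of l] by simp
    then have "(\<lambda>n. u n l) \<longlonglongrightarrow> exp (- 0\<^sup>2 / 2) * (cmod (FT f l))\<^sup>2"
      unfolding u_def by (intro tendsto_intros) auto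
    then have "(\<lambda>n. ennreal (u n l)) \<longlonglongrightarrow> ennreal ((cmod (FT f l))\<^sup>2)"
      by (intro tendsto_ennrealI) simp
    then show "ennreal ((cmod (FT f l))\<^sup>2) = liminf (\<lambda>n. ennreal (u n l))"
      by (simp only: lim_imp_Liminf[OF trivial_limit_sequentially])
  qed
  also have "\<dots> \<le> liminf (\<lambda>n. \<integral>\<^sup>+l. ennreal (u n l) \<partial>lebesgue)"
    by (rule nn_integral_liminf) measurable
  also have "\<dots> \<le> ennreal (2 * pi * (L2_norm f)\<^sup>2)"
    by (rule Liminf_le) (use u in auto)
  also have "2 * pi * (L2_norm f)\<^sup>2 = (sqrt (2 * pi) * L2_norm f)\<^sup>2"
    by (simp add: power_mult_distrib)
  finally show ?thesis
    by (subst L2_norm_le_iff_nn_integral) auto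
qed

section \<open>L2 limits of truncated Fourier integrals and the Dirichlet kernel\<close>

lemma FT_diff:
  assumes "integrable lebesgue f" "integrable lebesgue g"
  shows "FT (\<lambda>x. f x - g x) l = FT f l - FT g l"
proof -
  have "integrable lebesgue (\<lambda>x. f x * cnj (eigfun l x))" "integrable lebesgue (\<lambda>x. g x * cnj (eigfun l x))"
    by (rule integrable_mult_bounded[OF assms(1), of _ 1] integrable_mult_bounded[OF assms(2), of _ 1]; simp)+
  then show ?thesis unfolding FT_def left_diff_distrib by (rule Bochner_Integration.integral_diff)
qed

text \<open>The transforms of the truncations form a Cauchy family, since by the Bessel inequality their distances are controlled by
the tails of \<open>f\<close>.\<close>

lemma FT_clip_converges:
  assumes f: "f \<in> L2"
  shows "\<exists>F. L2_tendsto (\<lambda>R. FT (clip R f)) F at_top \<and> L2_norm F \<le> sqrt (2 * pi) * L2_norm f"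
proof -
  have clipI: "integrable lebesgue (clip R f)" and clipL: "clip R f \<in> L2" for R
    using clip_integrable clip_L2 f by auto
  have lim: "((\<lambda>R. L2_norm (\<lambda>x. clip R f x - f x)) \<longlongrightarrow> 0) at_top"
    by (rule L2_norm_tail_tendsto_0[OF f])
  have diff: "L2_norm (\<lambda>l. FT (clip R f) l - FT (clip Q f) l)
      \<le> sqrt (2 * pi) * (L2_norm (\<lambda>x. clip R f x - f x) + L2_norm (\<lambda>x. clip Q f x - f x))" for R Q
  proof -
    have "L2_norm (\<lambda>l. FT (clip R f) l - FT (clip Q f) l) = L2_norm (FT (\<lambda>x. clip R f x - clip Q f x))"
      by (rule arg_cong[of _ _ L2_norm], rule ext, rule FT_diff[OF clipI clipI, symmetric])
    also have "\<dots> \<le> sqrt (2 * pi) * L2_norm (\<lambda>x. clip R f x - clip Q f x)"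
      using FT_L2[of "\<lambda>x. clip R f x - clip Q f x"] clipI clipL by (simp add: L2_diff)
    also have "\<dots> \<le> sqrt (2 * pi) * (L2_norm (\<lambda>x. clip R f x - f x) + L2_norm (\<lambda>x. f x - clip Q f x))"
      by (intro mult_left_mono L2_norm_triangle_diff clipL f) simp
    finally show ?thesis by (simp add: L2_norm_minus_commute[of f])
  qed
  have "\<exists>F. L2_tendsto (\<lambda>R. FT (clip R f)) F at_top"
  proof (rule L2_complete)
    show "FT (clip R f) \<in> L2" for R using FT_L2[OF clipL clipI] by blast
    fix e :: real assume e: "e > 0"
    define c where "c = 2 * sqrt (2 * pi)"
    have c: "c > 0" by (simp add: c_def)
    have "\<forall>\<^sub>F R in at_top. L2_norm (\<lambda>x. clip R f x - f x) < e / c"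
      by (rule order_tendstoD(2)[OF lim]) (use e c in simp)
    then obtain N where N: "\<And>R. R \<ge> N \<Longrightarrow> L2_norm (\<lambda>x. clip R f x - f x) < e / c"
      unfolding eventually_at_top_linorder by blast
    have "L2_norm (\<lambda>l. FT (clip R f) l - FT (clip Q f) l) \<le> e" if "R \<ge> N" "Q \<ge> N" for R Q
    proof -
      have "sqrt (2 * pi) * (L2_norm (\<lambda>x. clip R f x - f x) + L2_norm (\<lambda>x. clip Q f x - f x))
          \<le> sqrt (2 * pi) * (e / c + e / c)"
        using N[OF that(1)] N[OF that(2)] by (intro mult_left_mono add_mono) auto
      also have "\<dots> = e" using c by (simp add: c_def)
      finally show ?thesis using diff[of R Q] by linarith
    qed
    then show "\<exists>N. \<forall>r\<ge>N. \<forall>q\<ge>N. L2_norm (\<lambda>x. FT (clip r f) x - FT (clip q f) x) \<le> e" by blast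
  qed
  then obtain F where F: "L2_tendsto (\<lambda>R. FT (clip R f)) F at_top" by blast
  have "L2_norm F \<le> sqrt (2 * pi) * L2_norm f"
  proof (rule tendsto_upperbound[OF L2_tendsto_norm[OF F]])
    have "L2_norm (FT (clip R f)) \<le> sqrt (2 * pi) * L2_norm f" for R
      by (rule order_trans[OF conjunct2[OF FT_L2[OF clipL clipI]] mult_left_mono[OF L2_norm_clip_le[OF f]]]) simp
    then show "\<forall>\<^sub>F R in at_top. L2_norm (FT (clip R f)) \<le> sqrt (2 * pi) * L2_norm f" by simp
  qed simp
  with F show ?thesis by blast
qed

lemma IFT_L2:
  assumes f: "f \<in> L2" and fi: "integrable lebesgue f"
  shows "IFT f \<in> L2"
proof -
  have "FT (\<lambda>l. cnj (f l)) \<in> L2" using FT_L2[OF L2_cnj[OF f]] fi by simp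
  from L2_cnj[OF this] show ?thesis by (simp add: IFT_eq_cnj_FT[abs_def])
qed

lemma IFT_clip_converges:
  assumes f: "f \<in> L2"
  shows "\<exists>h. L2_tendsto (\<lambda>R. IFT (clip R f)) h at_top \<and> L2_norm h \<le> sqrt (2 * pi) * L2_norm f"
proof -
  obtain F where F: "L2_tendsto (\<lambda>R. FT (clip R (\<lambda>x. cnj (f x)))) F at_top"
    "L2_norm F \<le> sqrt (2 * pi) * L2_norm (\<lambda>x. cnj (f x))"
    using FT_clip_converges[OF L2_cnj[OF f]] by blast
  have "L2_tendsto (\<lambda>R. IFT (clip R f)) (\<lambda>x. cnj (F x)) at_top"
    using L2_tendsto_cnj[OF F(1)] by (simp add: IFT_eq_cnj_FT[abs_def] clip_cnj)
  moreover have "L2_norm (\<lambda>x. cnj (F x)) \<le> sqrt (2 * pi) * L2_norm f"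
    using F(2) by (simp add: L2_norm_def)
  ultimately show ?thesis by blast
qed

text \<open>The Dirichlet kernel. The abbreviation \<open>sinc\<close> has the value \<open>1\<close> at the origin, which covers the case of equal frequencies.\<close>

lemma trunc_inner_eigfun:
  assumes R: "R \<ge> 0"
  shows "trunc_inner R (eigfun a) (eigfun b) = of_real (2 * R * sinc (R * (a - b)))"
proof -
  have e: "eigfun a x * cnj (eigfun b x) = eigfun (a - b) x" for x
    by (simp add: eigfun_def exp_cnj exp_add[symmetric] algebra_simps)
  have si: "set_integrable lebesgue {-R..R} (eigfun (a - b))"
    unfolding set_integrable_def
    by (subst integrable_completion)
       (auto intro!: borel_integrable_atLeastAtMost' eigfun_continuous simp: set_integrable_def[symmetric])
  have "trunc_inner R (eigfun a) (eigfun b) = integral {-R..R} (eigfun (a - b))"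
    unfolding trunc_inner_def e by (rule set_lebesgue_integral_eq_integral(2)[OF si])
  also have "\<dots> = of_real (2 * R * sinc (R * (a - b)))"
  proof (cases "a = b")
    case True
    have "eigfun 0 = (\<lambda>_. 1)" by (simp add: eigfun_def fun_eq_iff)
    then show ?thesis using True R by (simp add: scaleR_conv_of_real)
  next
    case False
    define t where "t = a - b"
    have t: "t \<noteq> 0" using False by (simp add: t_def)
    have "((\<lambda>x. \<i> / of_real t * eigfun t x) has_vector_derivative eigfun t x) (at x within {-R..R})" for x
    proof -
      have "((\<lambda>x. \<i> / of_real t * eigfun t x) has_vector_derivative \<i> / of_real t * (- \<i> * of_real t * eigfun t x)) (at x)"
        by (rule has_vector_derivative_mult_right[OF eigfun_has_vector_derivative])
      also have "\<i> / of_real t * (- \<i> * of_real t * eigfun t x) = eigfun t x"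
        using t by (simp add: field_simps)
      finally show ?thesis by (rule has_vector_derivative_at_within)
    qed
    then have "(eigfun t has_integral (\<i> / of_real t * eigfun t R - \<i> / of_real t * eigfun t (-R))) {-R..R}"
      using R by (intro fundamental_theorem_of_calculus) auto
    then have "integral {-R..R} (eigfun t) = \<i> / of_real t * (eigfun t R - eigfun t (-R))"
      by (simp add: integral_unique right_diff_distrib)
    also have "eigfun t R - eigfun t (-R) = - 2 * \<i> * of_real (sin (R * t))"
    proof -
      have "eigfun t R = cis (- (R * t))" "eigfun t (-R) = cis (R * t)"
        by (simp_all add: eigfun_def cis_conv_exp mult_ac)
      then show ?thesis by (simp add: complex_eq_iff)
    qed
    also have "\<i> / of_real t * (- 2 * \<i> * of_real (sin (R * t))) = of_real (2 * sin (R * t) / t)"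
      using t by (simp add: field_simps)
    also have "2 * sin (R * t) / t = 2 * R * sinc (R * t)" using t by simp
    finally show ?thesis by (simp add: t_def)
  qed
  finally show ?thesis .
qed

lemma Dirichlet_primitive:
  "((\<lambda>y. 2 * Si (R * (y - x))) has_real_derivative 2 * R * sinc (R * (y - x))) (at y)"
  by (rule derivative_eq_intros DERIV_chain2[OF DERIV_Si] refl | simp)+

lemma Si_odd: "Si (- T) = - Si T"
  using Si_neg[of T] Si_neg[of "- T"] by (cases "T \<ge> 0") auto

text \<open>Together with the boundedness of \<open>Si\<close>, this is the bounded convergence of the primitives of the Dirichlet kernels to a
multiple of the sign function.\<close>

lemma Si_scaled_limit: "((\<lambda>R. Si (R * t)) \<longlongrightarrow> pi / 2 * sgn t) at_top"
proof -
  have pos: "((\<lambda>R. Si (R * s)) \<longlongrightarrow> pi / 2) at_top" if "s > 0" for s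
    by (rule filterlim_compose[OF Si_at_top]) (intro filterlim_at_top_mult_tendsto_pos[OF tendsto_const that] filterlim_ident)
  consider "t > 0" | "t = 0" | "t < 0" by linarith
  then show ?thesis
  proof cases
    case 1 then show ?thesis using pos by simp
  next
    case 2 then show ?thesis using Si_odd[of 0] by simp
  next
    case 3
    then have "((\<lambda>R. - Si (R * (- t))) \<longlongrightarrow> - (pi / 2)) at_top"
      by (intro tendsto_minus pos) simp
    then show ?thesis using 3 by (simp add: Si_odd)
  qed
qed

text \<open>Transforming the indicator function of an interval back and forth, with a cut-off in between, integrates the Dirichlet
kernel over the interval.\<close>

lemma FT_clip_IFT_indicator:
  assumes ab: "a \<le> b" and R: "R \<ge> 0"
  shows "FT (clip R (IFT (indicator {a..b}))) x = of_real (2 * Si (R * (b - x)) - 2 * Si (R * (a - x)))"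
proof -
  have iR: "integrable lebesgue (clip R (\<lambda>l. cnj (eigfun x l)))"
  proof -
    have "integrable lebesgue (\<lambda>l. complex_of_real (indicator {-R..R} l))"
      by (intro integrable_of_real indicator_Icc_integrable)
    from integrable_mult_bounded[OF this, of "\<lambda>l. cnj (eigfun x l)" 1] show ?thesis
      by (simp add: clip_def[abs_def] scaleR_conv_of_real)
  qed
  have K: "IFT (clip R (\<lambda>l. cnj (eigfun x l))) y = of_real (2 * R * sinc (R * (y - x)))" for y
    unfolding trunc_inner_eigfun[OF R, symmetric] IFT_def trunc_inner_def set_lebesgue_integral_def clip_def
    by (simp add: eigfun_commute[of _ y] mult.commute)
  have "FT (clip R (IFT (indicator {a..b}))) x = (LINT l|lebesgue. IFT (indicator {a..b}) l * clip R (\<lambda>l. cnj (eigfun x l)) l)"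
    unfolding FT_def clip_def by (simp add: mult_ac)
  also have "\<dots> = (LINT y|lebesgue. indicator {a..b} y * IFT (clip R (\<lambda>l. cnj (eigfun x l))) y)"
    by (rule IFT_duality[OF indicator_Icc_integrable_complex iR])
  also have "\<dots> = (LINT y:{a..b}|lebesgue. of_real (2 * R * sinc (R * (y - x))))"
    unfolding K set_lebesgue_integral_def
    by (intro Bochner_Integration.integral_cong) (auto simp: indicator_def)
  also have "\<dots> = integral {a..b} (\<lambda>y. of_real (2 * R * sinc (R * (y - x))))"
  proof (rule set_lebesgue_integral_eq_integral(2))
    have c: "continuous_on {a..b} (\<lambda>y. complex_of_real (2 * R * sinc (R * (y - x))))"
      by (intro continuous_intros)
    show "set_integrable lebesgue {a..b} (\<lambda>y. complex_of_real (2 * R * sinc (R * (y - x))))"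
      using borel_integrable_atLeastAtMost'[OF c] unfolding set_integrable_def
      by (subst integrable_completion) (auto simp: borel_measurable_integrable)
  qed
  also have "\<dots> = of_real (2 * Si (R * (b - x))) - of_real (2 * Si (R * (a - x)))"
  proof (rule integral_unique, rule fundamental_theorem_of_calculus[OF ab, of "\<lambda>y. complex_of_real (2 * Si (R * (y - x)))"])
    fix y
    show "((\<lambda>y. complex_of_real (2 * Si (R * (y - x)))) has_vector_derivative
        complex_of_real (2 * R * sinc (R * (y - x)))) (at y within {a..b})"
      by (rule has_vector_derivative_of_real[OF has_field_derivative_at_within[OF Dirichlet_primitive]])
  qed
  finally show ?thesis by simp
qed

section \<open>Inversion, completeness and orthogonality\<close>

text \<open>The sets over which \<open>U\<close> integrates to zero form a Dynkin system; it contains the half-lines, a generator of the Borel sets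
that is stable under intersection, hence all Borel sets and, up to null sets, all Lebesgue measurable sets.\<close>

lemma AE_zero_if_half_line_integrals_zero:
  fixes U :: "real \<Rightarrow> complex"
  assumes U: "integrable lebesgue U" and total: "(LINT x|lebesgue. U x) = 0"
    and half: "\<And>a. (LINT x:{..a}|lebesgue. U x) = 0"
  shows "AE x in lebesgue. U x = 0"
proof (rule lebesgue.density_zero[OF U])
  have si: "set_integrable lebesgue A U" if "A \<in> sets lebesgue" for A
    unfolding set_integrable_def by (rule integrable_mult_indicator[OF that U])
  have borel0: "(LINT x:A|lebesgue. U x) = 0" if "A \<in> sets borel" for A
  proof -
    have gen: "sets borel = sigma_sets UNIV (range (\<lambda>a::real. {..a}))"
      by (subst borel_eq_atMost) simp
    have int: "Int_stable (range (\<lambda>a::real. {..a}))"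
    proof (rule Int_stableI_image)
      fix a b :: real
      show "\<exists>k\<in>UNIV. {..a} \<inter> {..b} = {..k}" by (intro bexI[of _ "min a b"]) auto
    qed
    have A: "A \<in> sigma_sets UNIV (range (\<lambda>a::real. {..a}))" using that by (simp add: gen)
    have in_leb: "B \<in> sets lebesgue" if "B \<in> sigma_sets UNIV (range (\<lambda>a::real. {..a}))" for B
      using that by (simp add: gen[symmetric])
    show ?thesis
    proof (induction rule: sigma_sets_induct_disjoint[OF int _ A])
      case 1 then show ?case by simp
    next
      case (2 B) then show ?case using half by auto
    next
      case 3 then show ?case by (simp add: set_lebesgue_integral_def)
    next
      case (4 B)
      have "(LINT x:UNIV - B|lebesgue. U x) = (LINT x|lebesgue. U x - indicator B x *\<^sub>R U x)"
        unfolding set_lebesgue_integral_def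
        by (intro Bochner_Integration.integral_cong) (auto simp: indicator_def)
      also have "\<dots> = (LINT x|lebesgue. U x) - (LINT x:B|lebesgue. U x)"
        using si[OF in_leb[OF 4(1)]] U unfolding set_lebesgue_integral_def set_integrable_def
        by (intro Bochner_Integration.integral_diff) auto
      finally show ?case using 4 total by simp
    next
      case (5 B)
      have "(LINT x:(\<Union>i. B i)|lebesgue. U x) = (\<Sum>i. LINT x:B i|lebesgue. U x)"
      proof (rule lebesgue_integral_countable_add)
        show "B i \<in> sets lebesgue" for i using 5(2) in_leb by blast
        then show "set_integrable lebesgue (\<Union>i. B i) U" by (intro si) auto
        show "B i \<inter> B j = {}" if "i \<noteq> j" for i j using 5(1) that by (auto simp: disjoint_family_on_def)
      qed
      then show ?case using 5(3) by simp
    qed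
  qed
  fix A :: "real set" assume A: "A \<in> sets lebesgue"
  then obtain S N N' where S: "A = S \<union> N" "S \<in> sets lborel" "N \<subseteq> N'" "N' \<in> null_sets lborel"
    by (auto elim!: sets_completionE)
  \<comment> \<open>A Lebesgue measurable set differs from the Borel set \<open>S\<close> only inside the null set \<open>N'\<close>.\<close>
  have ae: "AE x in lebesgue. x \<notin> N'"
    using AE_completion[OF AE_not_in[OF S(4)]] .
  have "(LINT x:A|lebesgue. U x) = (LINT x:S|lebesgue. U x)"
    unfolding set_lebesgue_integral_def
  proof (rule integral_cong_AE)
    show "(\<lambda>x. indicat_real A x *\<^sub>R U x) \<in> borel_measurable lebesgue"
      using si[OF A] by (simp add: set_integrable_def)
    have "S \<in> sets lebesgue" using S(2) by simp
    then show "(\<lambda>x. indicat_real S x *\<^sub>R U x) \<in> borel_measurable lebesgue"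
      using si by (simp add: set_integrable_def)
    show "AE x in lebesgue. indicat_real A x *\<^sub>R U x = indicat_real S x *\<^sub>R U x"
      using ae by eventually_elim (use S in \<open>auto simp: indicator_def\<close>)
  qed
  then show "(LINT x:A|lebesgue. U x) = 0" using borel0[of S] S(2) by simp
qed

text \<open>The Parseval identity for a truncated function and the indicator function of an interval. The integral over \<open>l\<close> is cut off
at \<open>R\<close>, where duality gives the integral of \<open>clip Q f\<close> against the Dirichlet integral of the indicator function. The
latter converges boundedly and \<open>clip Q f\<close> is integrable, so the limit may be taken under the integral.\<close>

lemma FT_clip_pairing:
  assumes f: "f \<in> L2" and ab: "a \<le> b"
  shows "(LINT l|lebesgue. FT (clip Q f) l * IFT (indicator {a..b}) l)
    = 2 * of_real pi * (LINT x|lebesgue. clip Q f x * indicator {a..b} x)"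
proof -
  define k where "k = IFT (indicator {a..b})"
  have k: "k \<in> L2" unfolding k_def by (intro IFT_L2 indicator_Icc_L2 indicator_Icc_integrable_complex)
  have g: "clip Q f \<in> L2" "integrable lebesgue (clip Q f)" using f by (auto intro: clip_L2 clip_integrable)
  have Tg: "FT (clip Q f) \<in> L2" using FT_L2[OF g] by simp
  obtain B where B: "\<And>T. \<bar>Si T\<bar> \<le> B" using bounded_Si by blast
  let ?d = "\<lambda>R x. complex_of_real (2 * Si (R * (b - x)) - 2 * Si (R * (a - x)))"
  \<comment> \<open>Equal to \<open>2 \<pi>\<close> inside the interval and to \<open>0\<close> outside; the end points form a null set.\<close>
  let ?s = "\<lambda>x. complex_of_real (pi * (sgn (b - x) - sgn (a - x)))"
  have [measurable]: "clip Q f \<in> borel_measurable lebesgue" using L2_measurable[OF g(1)] .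
  have dm: "?d R \<in> borel_measurable lebesgue" for R
    by (rule measurable_completion) measurable
  have sm: "?s \<in> borel_measurable lebesgue"
    by (rule measurable_completion) measurable
  have lim1: "((\<lambda>R. LINT x|lebesgue. clip Q f x * ?d R x) \<longlongrightarrow> (LINT x|lebesgue. clip Q f x * ?s x)) at_top"
  proof (rule integral_dominated_convergence_at_top)
    show "integrable lebesgue (\<lambda>x. cmod (clip Q f x) * (4 * B))" using g(2) by simp
    show "(\<lambda>x. clip Q f x * ?s x) \<in> borel_measurable lebesgue"
      by (intro borel_measurable_times sm) measurable
    show "(\<lambda>x. clip Q f x * ?d R x) \<in> borel_measurable lebesgue" for R
      by (intro borel_measurable_times dm) measurable
    show "AE x in lebesgue. ((\<lambda>R. clip Q f x * ?d R x) \<longlongrightarrow> clip Q f x * ?s x) at_top"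
    proof (rule AE_I2)
      fix x
      have "((\<lambda>R. ?d R x) \<longlongrightarrow> of_real (2 * (pi / 2 * sgn (b - x)) - 2 * (pi / 2 * sgn (a - x)))) at_top"
        by (intro tendsto_intros Si_scaled_limit)
      then have "((\<lambda>R. ?d R x) \<longlongrightarrow> ?s x) at_top" by (simp add: right_diff_distrib)
      then show "((\<lambda>R. clip Q f x * ?d R x) \<longlongrightarrow> clip Q f x * ?s x) at_top"
        by (rule tendsto_mult_left)
    qed
    have "norm (clip Q f x * ?d R x) \<le> cmod (clip Q f x) * (4 * B)" for R x
    proof -
      have "\<bar>2 * Si (R * (b - x)) - 2 * Si (R * (a - x))\<bar> \<le> 4 * B"
        using B[of "R * (b - x)"] B[of "R * (a - x)"] by linarith
      then show ?thesis unfolding norm_mult norm_of_real by (rule mult_left_mono) simp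
    qed
    then show "\<forall>\<^sub>F R in at_top. AE x in lebesgue. norm (clip Q f x * ?d R x) \<le> cmod (clip Q f x) * (4 * B)"
      by simp
  qed
  have lim2: "((\<lambda>R. LINT x|lebesgue. clip R k x * FT (clip Q f) x) \<longlongrightarrow> (LINT x|lebesgue. k x * FT (clip Q f) x)) at_top"
    by (rule L2_tendsto_pairing[OF clip_tendsto[OF k] Tg])
  have "(LINT x|lebesgue. clip R k x * FT (clip Q f) x) = (LINT x|lebesgue. clip Q f x * ?d R x)" if "R \<ge> 0" for R
  proof -
    have "(LINT x|lebesgue. clip R k x * FT (clip Q f) x) = (LINT x|lebesgue. FT (clip Q f) x * clip R k x)"
      by (simp add: mult.commute)
    also have "\<dots> = (LINT x|lebesgue. clip Q f x * FT (clip R k) x)"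
      by (rule FT_duality[OF g(2) clip_integrable[OF k]])
    finally show ?thesis by (simp only: k_def FT_clip_IFT_indicator[OF ab that])
  qed
  then have "\<forall>\<^sub>F R in at_top. (LINT x|lebesgue. clip R k x * FT (clip Q f) x) = (LINT x|lebesgue. clip Q f x * ?d R x)"
    by (rule eventually_mono[OF eventually_ge_at_top[of 0]])
  from Lim_transform_eventually[OF lim2 this] lim1
  have "(LINT x|lebesgue. k x * FT (clip Q f) x) = (LINT x|lebesgue. clip Q f x * ?s x)"
    by (rule tendsto_unique[OF trivial_limit_at_top_linorder])
  also have "\<dots> = (LINT x|lebesgue. 2 * of_real pi * (clip Q f x * indicator {a..b} x))"
  proof (rule integral_cong_AE)
    show "(\<lambda>x. clip Q f x * ?s x) \<in> borel_measurable lebesgue"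
      by (intro borel_measurable_times sm) measurable
    show "(\<lambda>x. 2 * of_real pi * (clip Q f x * indicator {a..b} x)) \<in> borel_measurable lebesgue"
      by (intro borel_measurable_times borel_measurable_const L2_measurable[OF indicator_Icc_L2]) measurable
    have "AE x in lebesgue. x \<notin> {a, b}"
      by (intro AE_completion AE_not_in finite_imp_null_set_lborel) simp
    then show "AE x in lebesgue. clip Q f x * ?s x = 2 * of_real pi * (clip Q f x * indicator {a..b} x)"
      by eventually_elim (use ab in \<open>auto simp: indicator_def sgn_if\<close>)
  qed
  finally show ?thesis by (simp add: k_def mult.commute)
qed

text \<open>Both sides equal the pairing of \<open>F\<close> with the inverse transform \<open>k\<close> of the indicator function: the left side by duality for the
inverse transform, the right side by the Parseval identity for the truncations of \<open>f\<close>.\<close>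

lemma Fourier_inversion_intervals:
  assumes f: "f \<in> L2" and F: "L2_tendsto (\<lambda>R. FT (clip R f)) F at_top"
    and h: "L2_tendsto (\<lambda>R. IFT (clip R F)) h at_top" and ab: "a \<le> b"
  shows "(LINT x|lebesgue. h x * indicator {a..b} x) = 2 * of_real pi * (LINT x|lebesgue. f x * indicator {a..b} x)"
proof -
  define k where "k = IFT (indicator {a..b})"
  have k: "k \<in> L2" unfolding k_def by (intro IFT_L2 indicator_Icc_L2 indicator_Icc_integrable_complex)
  have FL: "F \<in> L2" using F by (simp add: L2_tendsto_def)
  have "(LINT x|lebesgue. IFT (clip R F) x * indicator {a..b} x) = (LINT l|lebesgue. clip R F l * k l)" for R
    unfolding k_def by (rule IFT_duality[OF clip_integrable[OF FL] indicator_Icc_integrable_complex])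
  with L2_tendsto_pairing[OF h indicator_Icc_L2[of a b]]
  have "((\<lambda>R. LINT l|lebesgue. clip R F l * k l) \<longlongrightarrow> (LINT x|lebesgue. h x * indicator {a..b} x)) at_top"
    by simp
  from tendsto_unique[OF trivial_limit_at_top_linorder this L2_tendsto_pairing[OF clip_tendsto[OF FL] k]]
  have 1: "(LINT x|lebesgue. h x * indicator {a..b} x) = (LINT l|lebesgue. F l * k l)" .
  have "((\<lambda>Q. LINT l|lebesgue. FT (clip Q f) l * k l) \<longlongrightarrow> (LINT l|lebesgue. F l * k l)) at_top"
    by (rule L2_tendsto_pairing[OF F k])
  then have "((\<lambda>Q. 2 * of_real pi * (LINT x|lebesgue. clip Q f x * indicator {a..b} x)) \<longlongrightarrow> (LINT l|lebesgue. F l * k l)) at_top"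
    by (simp only: k_def FT_clip_pairing[OF f ab])
  moreover have "((\<lambda>Q. 2 * of_real pi * (LINT x|lebesgue. clip Q f x * indicator {a..b} x))
      \<longlongrightarrow> 2 * of_real pi * (LINT x|lebesgue. f x * indicator {a..b} x)) at_top"
    by (intro tendsto_mult_left L2_tendsto_pairing[OF clip_tendsto[OF f] indicator_Icc_L2])
  ultimately have "(LINT l|lebesgue. F l * k l) = 2 * of_real pi * (LINT x|lebesgue. f x * indicator {a..b} x)"
    by (rule tendsto_unique[OF trivial_limit_at_top_linorder])
  with 1 show ?thesis by simp
qed

text \<open>A function in \<open>L2\<close> need not be integrable on half-lines, so the previous criterion is applied to its truncations.\<close>

lemma AE_zero_if_interval_integrals_zero:
  assumes u: "u \<in> L2" and z: "\<And>a b. a \<le> b \<Longrightarrow> (LINT x|lebesgue. u x * indicator {a..b} x) = 0"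
  shows "AE x in lebesgue. u x = 0"
proof -
  have "AE x in lebesgue. clip (real n) u x = 0" for n
  proof (rule AE_zero_if_half_line_integrals_zero[OF clip_integrable[OF u]])
    show "(LINT x|lebesgue. clip (real n) u x) = 0"
      using z[of "- real n" "real n"]
      by (simp add: clip_def indicator_def of_bool_def if_distrib if_distribR cong: if_cong)
    fix a :: real
    have *: "(LINT x:{..a}|lebesgue. clip (real n) u x) = (LINT x|lebesgue. u x * indicator {- real n..min a (real n)} x)"
      unfolding set_lebesgue_integral_def clip_def
      by (intro Bochner_Integration.integral_cong) (auto simp: indicator_def)
    show "(LINT x:{..a}|lebesgue. clip (real n) u x) = 0"
    proof (cases "- real n \<le> min a (real n)")
      case True then show ?thesis unfolding * by (rule z)
    next
      case False then show ?thesis unfolding * by simp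
    qed
  qed
  then have "AE x in lebesgue. \<forall>n. clip (real n) u x = 0" by (simp add: AE_all_countable)
  then show ?thesis
  proof eventually_elim
    case (elim x)
    obtain n where "\<bar>x\<bar> \<le> real n" using real_arch_simple by blast
    with elim show ?case by (auto simp: clip_def indicator_def dest!: spec[of _ n])
  qed
qed

lemma Fourier_inversion_AE:
  assumes f: "f \<in> L2" and F: "L2_tendsto (\<lambda>R. FT (clip R f)) F at_top"
    and h: "L2_tendsto (\<lambda>R. IFT (clip R F)) h at_top"
  shows "AE x in lebesgue. h x = 2 * of_real pi * f x"
proof -
  have hL: "h \<in> L2" using h by (simp add: L2_tendsto_def)
  have "AE x in lebesgue. h x - 2 * of_real pi * f x = 0"
  proof (rule AE_zero_if_interval_integrals_zero)
    show "(\<lambda>x. h x - 2 * of_real pi * f x) \<in> L2" by (intro L2_diff L2_scale hL f)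
    fix a b :: real assume ab: "a \<le> b"
    have "(LINT x|lebesgue. (h x - 2 * of_real pi * f x) * indicator {a..b} x)
        = (LINT x|lebesgue. h x * indicator {a..b} x - 2 * of_real pi * (f x * indicator {a..b} x))"
      by (simp add: left_diff_distrib mult.assoc)
    also have "\<dots> = (LINT x|lebesgue. h x * indicator {a..b} x) - (LINT x|lebesgue. 2 * of_real pi * (f x * indicator {a..b} x))"
      by (intro Bochner_Integration.integral_diff integrable_mult_right L2_mult_integrable hL f indicator_Icc_L2)
    finally show "(LINT x|lebesgue. (h x - 2 * of_real pi * f x) * indicator {a..b} x) = 0"
      using Fourier_inversion_intervals[OF f F h ab] by simp
  qed
  then show ?thesis by simp
qed

text \<open>The norm estimate is the reverse of the Bessel inequality; it comes from the Bessel inequality for the inverse transform, since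
the inverse transform recovers \<open>f\<close>.\<close>

lemma Fourier_inversion:
  assumes f: "f \<in> L2" and F: "L2_tendsto (\<lambda>R. FT (clip R f)) F at_top"
  shows "L2_tendsto (\<lambda>R. IFT (clip R F)) (\<lambda>x. 2 * of_real pi * f x) at_top"
    and "2 * pi * L2_norm f \<le> sqrt (2 * pi) * L2_norm F"
proof -
  have FL: "F \<in> L2" using F by (simp add: L2_tendsto_def)
  obtain h where h: "L2_tendsto (\<lambda>R. IFT (clip R F)) h at_top" "L2_norm h \<le> sqrt (2 * pi) * L2_norm F"
    using IFT_clip_converges[OF FL] by blast
  have hL: "h \<in> L2" using h by (simp add: L2_tendsto_def)
  have ae: "AE x in lebesgue. h x = 2 * of_real pi * f x" by (rule Fourier_inversion_AE[OF f F h(1)])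
  have m: "(\<lambda>x. 2 * of_real pi * f x) \<in> borel_measurable lebesgue" by (rule L2_measurable[OF L2_scale[OF f]])
  show "L2_tendsto (\<lambda>R. IFT (clip R F)) (\<lambda>x. 2 * of_real pi * f x) at_top"
    by (rule L2_tendsto_cong_AE[OF h(1) m ae])
  have "L2_norm h = L2_norm (\<lambda>x. 2 * of_real pi * f x)"
    by (rule L2_norm_cong_AE[OF L2_measurable[OF hL] m ae])
  also have "\<dots> = 2 * pi * L2_norm f" by (simp add: L2_norm_scale norm_mult)
  finally show "2 * pi * L2_norm f \<le> sqrt (2 * pi) * L2_norm F" using h(2) by simp
qed

lemma trunc_inner_eq_FT: "trunc_inner R f (eigfun l) = FT (clip R f) l"
  unfolding trunc_inner_def FT_def clip_def set_lebesgue_integral_def by simp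

lemma complete_family_eigfun: "complete_family eigfun"
  unfolding complete_family_def generalized_coeffs_def
proof (intro ballI allI impI, elim conjE)
  fix f c assume f: "f \<in> L2"
    and c: "L2_tendsto (\<lambda>R l. trunc_inner R f (eigfun l)) c at_top" "AE l in lebesgue. c l = 0"
  have F: "L2_tendsto (\<lambda>R. FT (clip R f)) c at_top" using c(1) by (simp only: trunc_inner_eq_FT)
  then have "L2_norm c = 0" using c(2) L2_norm_eq_0_iff by (simp add: L2_tendsto_def)
  with Fourier_inversion(2)[OF f F] have "L2_norm f \<le> 0" using pi_gt_zero by (simp add: mult_le_0_iff)
  then have "L2_norm f = 0" by (simp add: order_antisym)
  then show "AE x in lebesgue. f x = 0" using L2_norm_eq_0_iff[OF f] by simp
qed

lemma Fourier_representation: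
  assumes f: "f \<in> L2"
  shows "\<exists>F. L2_tendsto (\<lambda>R l. 1 / (2 * of_real pi) *
            (LINT x:{-R..R}|lebesgue. f x * exp (\<i> * of_real l * of_real x))) F at_top
         \<and> L2_tendsto (\<lambda>R x.
            LINT l:{-R..R}|lebesgue. F l * exp (- \<i> * of_real l * of_real x)) f at_top"
proof -
  obtain F where F: "L2_tendsto (\<lambda>R. FT (clip R f)) F at_top"
    using FT_clip_converges[OF f] by blast
  define c :: complex where "c = 1 / (2 * of_real pi)"
  have 1: "(LINT x:{-R..R}|lebesgue. f x * exp (\<i> * of_real l * of_real x)) = FT (clip R f) l" for R l
    by (simp add: FT_def clip_def set_lebesgue_integral_def eigfun_def exp_cnj)
  have 2: "(LINT l:{-R..R}|lebesgue. c * F l * exp (- \<i> * of_real l * of_real x)) = c * IFT (clip R F) x" for R x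
    unfolding IFT_def integral_mult_right_zero[symmetric] set_lebesgue_integral_def
    by (intro Bochner_Integration.integral_cong) (simp_all add: clip_def eigfun_def)
  have "L2_tendsto (\<lambda>R x. c * IFT (clip R F) x) (\<lambda>x. c * (2 * of_real pi * f x)) at_top"
    by (rule L2_tendsto_scale[OF Fourier_inversion(1)[OF f F]])
  also have "(\<lambda>x. c * (2 * of_real pi * f x)) = f" by (simp add: c_def)
  finally have "L2_tendsto (\<lambda>R x. LINT l:{-R..R}|lebesgue. c * F l * exp (- \<i> * of_real l * of_real x)) f at_top"
    by (simp only: 2)
  moreover have "L2_tendsto (\<lambda>R l. c * (LINT x:{-R..R}|lebesgue. f x * exp (\<i> * of_real l * of_real x))) (\<lambda>l. c * F l) at_top"
    unfolding 1 by (rule L2_tendsto_scale[OF F])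
  ultimately show ?thesis unfolding c_def by blast
qed

text \<open>The constant is \<open>2 \<pi>\<close>. Integration by parts moves the derivative from the primitive of the Dirichlet kernel to the test
function, which vanishes at the ends of \<open>[-A, A]\<close>.\<close>

lemma delta_orthogonal_eigfun: "delta_orthogonal eigfun"
  unfolding delta_orthogonal_def
proof (intro exI[of _ "2 * complex_of_real pi"] conjI allI impI)
  show "2 * complex_of_real pi \<noteq> 0" by simp
  fix m :: real and \<phi> assume test: "test_function \<phi>"
  define \<phi>' where "\<phi>' x = vector_derivative \<phi> (at x)" for x
  have d: "((\<lambda>g x. vector_derivative g (at x)) ^^ n) \<phi> differentiable_on UNIV" for n
    using test by (simp add: test_function_def)
  have der: "(\<phi> has_vector_derivative \<phi>' x) (at x)" for x
    using d[of 0] unfolding \<phi>'_def by (simp add: differentiable_on_def vector_derivative_works[symmetric])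
  have cont': "continuous_on A \<phi>'" for A
    using d[of 1] differentiable_imp_continuous_on continuous_on_subset by (fastforce simp: \<phi>'_def[abs_def])
  have cont: "continuous_on A \<phi>" for A
    using d[of 0] differentiable_imp_continuous_on continuous_on_subset by fastforce
  have "bounded {x. \<phi> x \<noteq> 0}" using test by (simp add: test_function_def)
  then obtain A0 where A0: "\<And>x. \<phi> x \<noteq> 0 \<Longrightarrow> \<bar>x\<bar> \<le> A0" unfolding bounded_iff by auto
  \<comment> \<open>Large enough that \<open>\<phi>\<close> vanishes at both ends and that \<open>m\<close> is an interior point.\<close>
  define A where "A = max A0 \<bar>m\<bar> + 1"
  have Am: "- A < m" "m < A" "A > 0" by (auto simp: A_def)
  have A: "\<phi> x = 0" if "\<bar>x\<bar> \<ge> A" for x using A0[of x] that by (force simp: A_def)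
  have \<phi>A: "\<phi> A = 0" "\<phi> (- A) = 0" using A Am by auto
  obtain B where B: "\<And>T. \<bar>Si T\<bar> \<le> B" using bounded_Si by blast
  let ?S = "\<lambda>R l. complex_of_real (2 * Si (R * (l - m)))"
  let ?D = "\<lambda>R l. complex_of_real (2 * R * sinc (R * (l - m)))"
  have Si_cont: "continuous_on X Si" for X
    by (intro continuous_at_imp_continuous_on ballI isCont_Si)
  have S_cont: "continuous_on X (?S R)" for X R
    by (intro continuous_intros continuous_on_compose2[OF Si_cont[of UNIV]]) auto
  have parts: "(LINT l|lebesgue. \<phi> l * trunc_inner R (eigfun l) (eigfun m))
     = - (LINT l:{-A..A}|lebesgue. \<phi>' l * ?S R l)" if R: "R \<ge> 0" for R
  proof -
    have "(LINT l|lebesgue. \<phi> l * trunc_inner R (eigfun l) (eigfun m)) = (LINT l:{-A..A}|lebesgue. \<phi> l * ?D R l)"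
      unfolding trunc_inner_eigfun[OF R] set_lebesgue_integral_def
      by (intro Bochner_Integration.integral_cong) (use A in \<open>auto simp: indicator_def\<close>)
    also have "\<dots> = integral {-A..A} (\<lambda>l. \<phi> l * ?D R l)"
      by (intro set_lebesgue_integral_eq_integral(2) absolutely_integrable_continuous_real continuous_intros cont)
    finally have 1: "(LINT l|lebesgue. \<phi> l * trunc_inner R (eigfun l) (eigfun m)) = integral {-A..A} (\<lambda>l. \<phi> l * ?D R l)" .
    have 2: "(LINT l:{-A..A}|lebesgue. \<phi>' l * ?S R l) = integral {-A..A} (\<lambda>l. \<phi>' l * ?S R l)"
      by (intro set_lebesgue_integral_eq_integral(2) absolutely_integrable_continuous_real continuous_on_mult cont' S_cont)
    have "((\<lambda>l. \<phi> l * ?D R l + \<phi>' l * ?S R l) has_integral (\<phi> A * ?S R A - \<phi> (-A) * ?S R (-A))) {-A..A}"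
    proof (rule fundamental_theorem_of_calculus)
      fix l
      have "(?S R has_vector_derivative ?D R l) (at l)"
        by (intro has_vector_derivative_of_real Dirichlet_primitive)
      from has_vector_derivative_mult[OF der this]
      show "((\<lambda>l. \<phi> l * ?S R l) has_vector_derivative \<phi> l * ?D R l + \<phi>' l * ?S R l) (at l within {-A..A})"
        by (rule has_vector_derivative_at_within)
    qed (use Am in auto)
    then have "integral {-A..A} (\<lambda>l. \<phi> l * ?D R l + \<phi>' l * ?S R l) = 0"
      by (simp add: integral_unique \<phi>A)
    moreover have "integral {-A..A} (\<lambda>l. \<phi> l * ?D R l + \<phi>' l * ?S R l)
       = integral {-A..A} (\<lambda>l. \<phi> l * ?D R l) + integral {-A..A} (\<lambda>l. \<phi>' l * ?S R l)"
      by (intro Henstock_Kurzweil_Integration.integral_add integrable_continuous_real continuous_intros cont cont' S_cont)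
    ultimately show ?thesis using 1 2 by (simp add: eq_neg_iff_add_eq_0)
  qed
  let ?s = "\<lambda>l. complex_of_real (pi * sgn (l - m))"
  have \<phi>'_int: "set_integrable lebesgue {-A..A} \<phi>'"
    by (intro absolutely_integrable_continuous_real cont')
  have \<phi>'_meas: "(\<lambda>l. indicator {-A..A} l *\<^sub>R \<phi>' l) \<in> borel_measurable lebesgue"
    using \<phi>'_int by (simp add: set_integrable_def)
  have s_meas: "?s \<in> borel_measurable lebesgue"
    by (rule measurable_completion) measurable
  have S_meas: "?S R \<in> borel_measurable lebesgue" for R
    by (rule measurable_completion) measurable
  have lim: "((\<lambda>R. LINT l:{-A..A}|lebesgue. \<phi>' l * ?S R l) \<longlongrightarrow> (LINT l:{-A..A}|lebesgue. \<phi>' l * ?s l)) at_top"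
    unfolding set_lebesgue_integral_def mult_scaleR_left[symmetric]
  proof (rule integral_dominated_convergence_at_top)
    show "integrable lebesgue (\<lambda>l. cmod (indicator {-A..A} l *\<^sub>R \<phi>' l) * (2 * B))"
      using \<phi>'_int unfolding set_integrable_def by (intro integrable_mult_left integrable_norm)
    show "(\<lambda>l. (indicator {-A..A} l *\<^sub>R \<phi>' l) * ?s l) \<in> borel_measurable lebesgue"
      by (intro borel_measurable_times s_meas \<phi>'_meas)
    show "(\<lambda>l. (indicator {-A..A} l *\<^sub>R \<phi>' l) * ?S R l) \<in> borel_measurable lebesgue" for R
      by (intro borel_measurable_times S_meas \<phi>'_meas)
    show "AE l in lebesgue. ((\<lambda>R. (indicator {-A..A} l *\<^sub>R \<phi>' l) * ?S R l) \<longlongrightarrow> (indicator {-A..A} l *\<^sub>R \<phi>' l) * ?s l) at_top"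
    proof (rule AE_I2)
      fix l
      have "((\<lambda>R. ?S R l) \<longlongrightarrow> of_real (2 * (pi / 2 * sgn (l - m)))) at_top"
        by (intro tendsto_intros Si_scaled_limit)
      then have "((\<lambda>R. ?S R l) \<longlongrightarrow> ?s l) at_top" by simp
      then show "((\<lambda>R. (indicator {-A..A} l *\<^sub>R \<phi>' l) * ?S R l) \<longlongrightarrow> (indicator {-A..A} l *\<^sub>R \<phi>' l) * ?s l) at_top"
        by (rule tendsto_mult_left)
    qed
    have "norm ((indicator {-A..A} l *\<^sub>R \<phi>' l) * ?S R l) \<le> cmod (indicator {-A..A} l *\<^sub>R \<phi>' l) * (2 * B)" for R l
    proof -
      have "\<bar>2 * Si (R * (l - m))\<bar> \<le> 2 * B" using B[of "R * (l - m)"] by linarith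
      then show ?thesis unfolding norm_mult norm_of_real by (rule mult_left_mono) simp
    qed
    then show "\<forall>\<^sub>F R in at_top. AE l in lebesgue. norm ((indicator {-A..A} l *\<^sub>R \<phi>' l) * ?S R l)
        \<le> cmod (indicator {-A..A} l *\<^sub>R \<phi>' l) * (2 * B)"
      by simp
  qed
  \<comment> \<open>Integrating \<open>\<phi>'\<close> separately to the left and to the right of the jump at \<open>m\<close>.\<close>
  have val: "(LINT l:{-A..A}|lebesgue. \<phi>' l * ?s l) = - (2 * of_real pi * \<phi> m)"
  proof -
    have ftc: "(\<phi>' has_integral (\<phi> v - \<phi> u)) {u..v}" if "u \<le> v" for u v
      by (rule fundamental_theorem_of_calculus[OF that has_vector_derivative_at_within[OF der]])
    have left: "((\<lambda>l. \<phi>' l * ?s l) has_integral ((\<phi> m - \<phi> (-A)) * of_real (- pi))) {-A..m}"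
    proof (rule has_integral_spike[of "{m}"])
      show "((\<lambda>l. \<phi>' l * of_real (- pi)) has_integral ((\<phi> m - \<phi> (-A)) * of_real (- pi))) {-A..m}"
        by (intro has_integral_mult_left ftc) (use Am in simp)
    qed auto
    have right: "((\<lambda>l. \<phi>' l * ?s l) has_integral ((\<phi> A - \<phi> m) * of_real pi)) {m..A}"
    proof (rule has_integral_spike[of "{m}"])
      show "((\<lambda>l. \<phi>' l * of_real pi) has_integral ((\<phi> A - \<phi> m) * of_real pi)) {m..A}"
        by (intro has_integral_mult_left ftc) (use Am in simp)
    qed auto
    have "((\<lambda>l. \<phi>' l * ?s l) has_integral ((\<phi> m - \<phi> (-A)) * of_real (- pi) + (\<phi> A - \<phi> m) * of_real pi)) {-A..A}"
      by (rule has_integral_combine[OF _ _ left right]) (use Am in auto)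
    then have "integral {-A..A} (\<lambda>l. \<phi>' l * ?s l) = - (2 * of_real pi * \<phi> m)"
      by (simp add: integral_unique \<phi>A)
    moreover have "set_integrable lebesgue {-A..A} (\<lambda>l. \<phi>' l * ?s l)"
    proof -
      have "integrable lebesgue (\<lambda>l. (indicator {-A..A} l *\<^sub>R \<phi>' l) * ?s l)"
      proof (rule integrable_mult_bounded[OF _ s_meas])
        show "integrable lebesgue (\<lambda>l. indicator {-A..A} l *\<^sub>R \<phi>' l)" using \<phi>'_int by (simp add: set_integrable_def)
        show "cmod (?s l) \<le> pi" for l by (simp add: norm_mult sgn_if)
      qed
      then show ?thesis by (simp add: set_integrable_def)
    qed
    ultimately show ?thesis using set_lebesgue_integral_eq_integral(2) by metis
  qed
  have "\<forall>\<^sub>F R in at_top. - (LINT l:{-A..A}|lebesgue. \<phi>' l * ?S R l) = (LINT l|lebesgue. \<phi> l * trunc_inner R (eigfun l) (eigfun m))"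
    using parts by (intro eventually_mono[OF eventually_ge_at_top[of 0]]) simp
  from Lim_transform_eventually[OF tendsto_minus[OF lim] this]
  show "((\<lambda>R. LINT l|lebesgue. \<phi> l * trunc_inner R (eigfun l) (eigfun m)) \<longlongrightarrow> 2 * complex_of_real pi * \<phi> m) at_top"
    by (simp only: val minus_minus)
qed

theorem theorem4:
  shows "continuous_spectrum dom_M op_M = (\<real> :: complex set)
    \<and> (\<forall>l::real. continuum_eigenfunction dom_M op_M (of_real l) (eigfun l)
         \<and> eigfun l \<notin> L2
         \<and> (\<forall>x. eigfun l differentiable at x \<and> op_M (eigfun l) x = of_real l * eigfun l x))
    \<and> delta_orthogonal eigfun
    \<and> complete_family eigfun
    \<and> (\<forall>f\<in>L2. \<exists>F.
         L2_tendsto (\<lambda>R l. 1 / (2 * of_real pi) *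
            (LINT x:{-R..R}|lebesgue. f x * exp (\<i> * of_real l * of_real x))) F at_top
         \<and> L2_tendsto (\<lambda>R x.
            LINT l:{-R..R}|lebesgue. F l * exp (- \<i> * of_real l * of_real x)) f at_top)"
proof (intro conjI allI ballI)
  show "continuous_spectrum dom_M op_M = \<real>" by (rule continuous_spectrum_M)
  show "delta_orthogonal eigfun" by (rule delta_orthogonal_eigfun)
  show "complete_family eigfun" by (rule complete_family_eigfun)
  show "continuum_eigenfunction dom_M op_M (of_real l) (eigfun l)" for l by (rule eigfun_continuum_eigenfunction)
  show "eigfun l \<notin> L2" for l by (rule eigfun_not_L2)
  show "eigfun l differentiable at x" for l x
    by (rule differentiableI_vector[OF eigfun_has_vector_derivative])
  show "op_M (eigfun l) x = of_real l * eigfun l x" for l x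
    by (simp add: op_M_def vector_derivative_at[OF eigfun_has_vector_derivative] mult.assoc[symmetric])
qed (rule Fourier_representation)

end
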